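(* Let $\alpha$ be an r.e. real and let $V$ be an optimal computer. For every total recursive function $f\colon\mathbb{N}^+\to\mathbb{N}$, if $f$ is not bounded from above, then there exist an oracle deterministic Turing machine $M$ and $c\in\mathbb{N}$ such that, for infinitely many $n\in\mathbb{N}^+$, $M^{\mathrm{Dom}\,V\restriction n}(n)=\alpha\restriction(n-f(n)-c)$.
   Context: A real $\alpha$ is r.e. if there is a total recursive $g\colon\mathbb{N}^+\to\mathbb{Q}$ with $g(n)\le\alpha$ for all $n$ and $\lim_n g(n)=\alpha$. $\{0,1\}^*$ is the set of finite binary strings. A computer is a partial recursive function $C\colon\{0,1\}^*\to\{0,1\}^*$ whose domain $\mathrm{Dom}\,C$ is prefix-free. A computer $U$ is optimal if for every computer $C$ there is $d\in\mathbb{N}$ such that for every $p\in\mathrm{Dom}\,C$ there is $q$ with $U(q)=C(p)$ and $|q|\le|p|+d$. For $S\subseteq\{0,1\}^*$ and $n\in\mathbb{Z}$, $S\restriction n=\{s\in S:|s|\le n\}$. For a real $\alpha$ and $n\in\mathbb{N}^+$, $\alpha\restriction n$ is the string of the first $n$ bits of the base-two expansion of $\alpha-\lfloor\alpha\rfloor$ (with infinitely many zeros when there is a choice); for integers $n\le0$ it is the empty string. $M^A(n)$ is the output of oracle machine $M$ on input $n$ with oracle set $A$. *)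

theory Defs
  imports Complex_Main "HOL-Library.Sublist"
begin

section \<open>Partial recursive functions\<close>

text \<open>
  Kleene's partial recursive functions: a term denotes a partial function on argument lists.
  Arities are not tracked: an argument list that is too short makes the value undefined, so on
  lists of any fixed length \<open>k\<close> the terms denote exactly the \<open>k\<close>-ary partial recursive functions.
\<close>

datatype recf =
    Zero
  | Succ
  | Proj nat
  | Comp recf "recf list"
  | PrimRec recf recf
  | Mu recf

primrec reval :: "recf \<Rightarrow> nat list \<Rightarrow> nat option" where
  "reval Zero = (\<lambda>xs. Some 0)"
| "reval Succ = (\<lambda>xs. case xs of [] \<Rightarrow> None | x # _ \<Rightarrow> Some (Suc x))"
| "reval (Proj i) = (\<lambda>xs. if i < length xs then Some (xs ! i) else None)"
| "reval (Comp h gs) =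
     (\<lambda>xs. let vs = map (\<lambda>g. reval g xs) gs
           in if None \<in> set vs then None else reval h (map the vs))"
| "reval (PrimRec g h) =
     (\<lambda>xs. case xs of [] \<Rightarrow> None
           | n # ys \<Rightarrow> rec_nat (reval g ys)
                        (\<lambda>m r. case r of None \<Rightarrow> None | Some v \<Rightarrow> reval h (m # v # ys)) n)"
| "reval (Mu h) =
     (\<lambda>xs. if \<exists>z. reval h (z # xs) = Some 0 \<and> (\<forall>y<z. \<exists>v. reval h (y # xs) = Some (Suc v))
           then Some (LEAST z. reval h (z # xs) = Some 0) else None)"

text \<open>
  Functions with domain $\mathbb{N}^+$ are rendered as functions on \<^typ>\<open>nat\<close> whose value at \<open>0\<close>
  is ignored throughout.
\<close>

definition total_recursive_nat :: "(nat \<Rightarrow> nat) \<Rightarrow> bool" where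
  "total_recursive_nat f \<longleftrightarrow> (\<exists>r. \<forall>n\<ge>1. reval r [n] = Some (f n))"

definition total_recursive_rat :: "(nat \<Rightarrow> rat) \<Rightarrow> bool" where
  "total_recursive_rat g \<longleftrightarrow>
     (\<exists>s a b. total_recursive_nat s \<and> total_recursive_nat a \<and> total_recursive_nat b \<and>
        (\<forall>n\<ge>1. b n \<noteq> 0 \<and> g n = (- 1) ^ s n * of_nat (a n) / of_nat (b n)))"

text \<open>The bijection between binary strings and natural numbers given by bijective base-two notation.\<close>

primrec str_code :: "bool list \<Rightarrow> nat" where
  "str_code [] = 0"
| "str_code (b # bs) = 2 * str_code bs + (if b then 2 else 1)"

lemma bij_str_code: "bij str_code"
proof (rule bijI)
  show "inj str_code"
  proof (rule injI)
    fix x y :: "bool list"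
    show "str_code x = str_code y \<Longrightarrow> x = y"
    proof (induction x arbitrary: y)
      case Nil
      then show ?case by (cases y) (auto split: if_splits)
    next
      case (Cons b bs)
      then show ?case by (cases y) (auto split: if_splits, presburger+)
    qed
  qed
  have "\<exists>x. str_code x = n" for n
  proof (induction n rule: less_induct)
    case (less n)
    show ?case
    proof (cases "n = 0")
      case True
      then show ?thesis by (intro exI[of _ "[]"]) simp
    next
      case False
      then have "(n - 1) div 2 < n" by linarith
      then obtain x where x: "str_code x = (n - 1) div 2"
        using less by blast
      have "str_code (even n # x) = n"
        using False x by simp presburger
      then show ?thesis by blast
    qed
  qed
  then show "surj str_code" by (metis surjI)
qed

definition partial_recursive_str :: "(bool list \<Rightarrow> bool list option) \<Rightarrow> bool" where
  "partial_recursive_str C \<longleftrightarrow> (\<exists>r. \<forall>p. reval r [str_code p] = map_option str_code (C p))"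

section \<open>Computers\<close>

definition prefix_free :: "bool list set \<Rightarrow> bool" where
  "prefix_free S \<longleftrightarrow> (\<forall>p\<in>S. \<forall>q\<in>S. \<not> strict_prefix p q)"

definition computer :: "(bool list \<Rightarrow> bool list option) \<Rightarrow> bool" where
  "computer C \<longleftrightarrow> partial_recursive_str C \<and> prefix_free (dom C)"

definition optimal_computer :: "(bool list \<Rightarrow> bool list option) \<Rightarrow> bool" where
  "optimal_computer U \<longleftrightarrow> computer U \<and>
     (\<forall>C. computer C \<longrightarrow>
        (\<exists>d::nat. \<forall>p\<in>dom C. \<exists>q\<in>dom U. U q = C p \<and> length q \<le> length p + d))"

definition strings_upto :: "bool list set \<Rightarrow> int \<Rightarrow> bool list set" where
  "strings_upto S n = {s \<in> S. int (length s) \<le> n}"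

section \<open>Reals\<close>

definition re_real :: "real \<Rightarrow> bool" where
  "re_real \<alpha> \<longleftrightarrow>
     (\<exists>g. total_recursive_rat g \<and> (\<forall>n\<ge>1. of_rat (g n) \<le> \<alpha>) \<and>
          (\<lambda>n. of_rat (g n)) \<longlonglongrightarrow> \<alpha>)"

text \<open>
  \<open>b\<close> lists the bits after the binary point, starting with index \<open>0\<close>; the requirement of infinitely
  many zeros makes the expansion unique.
\<close>

definition is_bin_expansion :: "real \<Rightarrow> (nat \<Rightarrow> bool) \<Rightarrow> bool" where
  "is_bin_expansion x b \<longleftrightarrow> infinite {i. \<not> b i} \<and> (\<lambda>i. of_bool (b i) / 2 ^ Suc i) sums x"

definition bin_expansion :: "real \<Rightarrow> nat \<Rightarrow> bool" where
  "bin_expansion \<alpha> = (THE b. is_bin_expansion (\<alpha> - of_int \<lfloor>\<alpha>\<rfloor>) b)"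

definition real_prefix :: "real \<Rightarrow> int \<Rightarrow> bool list" where
  "real_prefix \<alpha> n = map (bin_expansion \<alpha>) [0..<nat n]"

lemma is_bin_expansion_iff:
  fixes x :: real
  assumes x: "0 \<le> x" "x < 1"
  shows "is_bin_expansion x b \<longleftrightarrow> b = (\<lambda>i. odd \<lfloor>2 ^ Suc i * x\<rfloor>)"
proof
  assume "is_bin_expansion x b"
  then have inf: "infinite {i. \<not> b i}" and s: "(\<lambda>i. of_bool (b i) / 2 ^ Suc i :: real) sums x"
    by (auto simp: is_bin_expansion_def)
  define k :: "nat \<Rightarrow> int" where "k = rec_nat 0 (\<lambda>n r. 2 * r + of_bool (b n))"
  have kSuc: "k (Suc n) = 2 * k n + of_bool (b n)" for n
    by (simp add: k_def)
  have part: "(\<Sum>i<n. of_bool (b i) / 2 ^ Suc i) = real_of_int (k n) / 2 ^ n" for n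
  proof (induction n)
    case 0
    then show ?case by (simp add: k_def)
  next
    case (Suc n)
    then show ?case by (simp add: kSuc field_simps)
  qed
  have fl: "\<lfloor>2 ^ n * x\<rfloor> = k n" for n
  proof -
    let ?t = "\<lambda>i. of_bool (b (i + n)) / 2 ^ Suc (i + n) :: real"
    let ?h = "\<lambda>i. (1/2::real) ^ Suc i / 2 ^ n"
    have t: "?t sums (x - real_of_int (k n) / 2 ^ n)"
      using sums_split_initial_segment[OF s, of n] by (simp only: part)
    have h: "?h sums (1 / 2 ^ n)"
      using sums_divide[OF power_half_series] .
    have d: "(\<lambda>i. ?h i - ?t i) sums (1 / 2 ^ n - (x - real_of_int (k n) / 2 ^ n))"
      using sums_diff[OF h t] .
    have le: "?t i \<le> ?h i" for i
      by (simp add: power_add field_simps)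
    have "\<not> {i. \<not> b i} \<subseteq> {..<n}"
      using inf finite_subset[OF _ finite_lessThan] by blast
    then obtain j where j: "j \<ge> n" "\<not> b j"
      by (auto simp: subset_iff not_less)
    have "0 < suminf (\<lambda>i. ?h i - ?t i)"
    proof (rule suminf_pos2[where i = "j - n"])
      show "summable (\<lambda>i. ?h i - ?t i)" using d by (rule sums_summable)
      show "0 \<le> ?h i - ?t i" for i using le[of i] by simp
      show "0 < ?h (j - n) - ?t (j - n)" using j by simp
    qed
    then have 1: "x - real_of_int (k n) / 2 ^ n < 1 / 2 ^ n"
      using sums_unique[OF d] by simp
    have 2: "0 \<le> x - real_of_int (k n) / 2 ^ n"
      by (rule sums_le[OF _ sums_zero t]) simp
    have "x < (real_of_int (k n) + 1) / 2 ^ n" "real_of_int (k n) / 2 ^ n \<le> x"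
      using 1 2 unfolding add_divide_distrib by linarith+
    then have "x * 2 ^ n < real_of_int (k n) + 1" "real_of_int (k n) \<le> x * 2 ^ n"
      by (simp_all add: pos_less_divide_eq pos_divide_le_eq)
    then show ?thesis
      by (intro floor_unique) (simp_all add: mult.commute)
  qed
  show "b = (\<lambda>i. odd \<lfloor>2 ^ Suc i * x\<rfloor>)"
    unfolding fl by (rule ext) (simp add: kSuc)
next
  assume b: "b = (\<lambda>i. odd \<lfloor>2 ^ Suc i * x\<rfloor>)"
  have kSuc: "\<lfloor>2 ^ Suc n * x\<rfloor> = 2 * \<lfloor>2 ^ n * x\<rfloor> + of_bool (b n)" for n
  proof -
    have "\<lfloor>2 ^ Suc n * x\<rfloor> = 2 * \<lfloor>2 ^ n * x\<rfloor> \<or> \<lfloor>2 ^ Suc n * x\<rfloor> = 2 * \<lfloor>2 ^ n * x\<rfloor> + 1"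
      unfolding power_Suc mult.assoc by linarith
    moreover have "b n = odd \<lfloor>2 ^ Suc n * x\<rfloor>" by (simp only: b)
    ultimately show ?thesis by auto
  qed
  have part: "(\<Sum>i<n. of_bool (b i) / 2 ^ Suc i) = real_of_int \<lfloor>2 ^ n * x\<rfloor> / 2 ^ n" for n
  proof (induction n)
    case 0
    have "\<lfloor>x\<rfloor> = 0" using x by linarith
    then show ?case by simp
  next
    case (Suc n)
    have "real_of_int \<lfloor>2 ^ Suc n * x\<rfloor> = 2 * real_of_int \<lfloor>2 ^ n * x\<rfloor> + of_bool (b n)"
      unfolding kSuc by simp
    then show ?case using Suc by (simp add: add_divide_distrib)
  qed
  have lim: "(\<lambda>n. real_of_int \<lfloor>2 ^ n * x\<rfloor> / 2 ^ n) \<longlonglongrightarrow> x"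
  proof (rule tendsto_sandwich)
    have lo: "x - (1/2) ^ n \<le> real_of_int \<lfloor>2 ^ n * x\<rfloor> / 2 ^ n" for n
    proof -
      have "2 ^ n * x - 1 \<le> real_of_int \<lfloor>2 ^ n * x\<rfloor>" by linarith
      then have "(2 ^ n * x - 1) / 2 ^ n \<le> real_of_int \<lfloor>2 ^ n * x\<rfloor> / 2 ^ n"
        by (rule divide_right_mono) simp
      then show ?thesis by (simp add: diff_divide_distrib power_one_over)
    qed
    show "\<forall>\<^sub>F n in sequentially. x - (1/2) ^ n \<le> real_of_int \<lfloor>2 ^ n * x\<rfloor> / 2 ^ n"
      using lo by simp
    show "\<forall>\<^sub>F n in sequentially. real_of_int \<lfloor>2 ^ n * x\<rfloor> / 2 ^ n \<le> x"
    proof (rule always_eventually, rule allI)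
      fix n
      have "real_of_int \<lfloor>2 ^ n * x\<rfloor> \<le> x * 2 ^ n" by (simp add: mult.commute)
      then show "real_of_int \<lfloor>2 ^ n * x\<rfloor> / 2 ^ n \<le> x" by (simp add: pos_divide_le_eq)
    qed
    have "(\<lambda>n. (1/2::real) ^ n) \<longlonglongrightarrow> 0" by (rule LIMSEQ_power_zero) simp
    from tendsto_diff[OF tendsto_const this]
    show "(\<lambda>n. x - (1/2) ^ n) \<longlonglongrightarrow> x" by simp
    show "(\<lambda>n. x) \<longlonglongrightarrow> x" by simp
  qed
  have s: "(\<lambda>i. of_bool (b i) / 2 ^ Suc i) sums x"
    unfolding sums_def part by (rule lim)
  have "infinite {i. \<not> b i}"
  proof
    assume "finite {i. \<not> b i}"
    then obtain n where n: "\<And>i. i \<ge> n \<Longrightarrow> b i"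
      by (metis (mono_tags, lifting) finite_nat_set_iff_bounded mem_Collect_eq not_le)
    have "(\<lambda>i. of_bool (b (i + n)) / 2 ^ Suc (i + n) :: real)
            = (\<lambda>i. (1/2) ^ Suc i / 2 ^ n)"
      using n by (auto simp: fun_eq_iff power_add field_simps)
    with sums_split_initial_segment[OF s, of n]
    have "(\<lambda>i. (1/2::real) ^ Suc i / 2 ^ n) sums (x - real_of_int \<lfloor>2 ^ n * x\<rfloor> / 2 ^ n)"
      by (simp only: part)
    from sums_unique2[OF this sums_divide[OF power_half_series]]
    have "x - real_of_int \<lfloor>2 ^ n * x\<rfloor> / 2 ^ n = 1 / 2 ^ n" .
    then have "2 ^ n * x = real_of_int \<lfloor>2 ^ n * x\<rfloor> + 1"
      by (simp add: field_simps)
    then show False by linarith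
  qed
  with s show "is_bin_expansion x b" by (simp add: is_bin_expansion_def)
qed

lemma bin_expansion_floor:
  "bin_expansion \<alpha> i \<longleftrightarrow> odd \<lfloor>2 ^ Suc i * (\<alpha> - of_int \<lfloor>\<alpha>\<rfloor>)\<rfloor>"
proof -
  have "0 \<le> \<alpha> - of_int \<lfloor>\<alpha>\<rfloor>" "\<alpha> - of_int \<lfloor>\<alpha>\<rfloor> < 1" by linarith+
  note * = is_bin_expansion_iff[OF this]
  show ?thesis unfolding bin_expansion_def * by simp
qed

section \<open>Oracle deterministic Turing machines\<close>

text \<open>
  A tape is a two-way infinite sequence of cells, each blank (\<^term>\<open>None\<close>) or holding a bit. It is
  stored relative to its head: cell \<open>0\<close> is the scanned cell, cell \<open>i\<close> is the \<open>i\<close>-th cell to the right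
  of it, and moving the head shifts the sequence.
\<close>

type_synonym tape = "int \<Rightarrow> bool option"

definition tape_of :: "bool list \<Rightarrow> tape" where
  "tape_of w = (\<lambda>i. if 0 \<le> i \<and> i < int (length w) then Some (w ! nat i) else None)"

text \<open>The string on a tape extends from the scanned cell to the first blank on its right.\<close>

definition tape_string :: "tape \<Rightarrow> bool list \<Rightarrow> bool" where
  "tape_string t w \<longleftrightarrow> (\<forall>i<length w. t (int i) = Some (w ! i)) \<and> t (int (length w)) = None"

datatype move = MoveLeft | Stay | MoveRight

fun tape_act :: "bool option \<times> move \<Rightarrow> tape \<Rightarrow> tape" where
  "tape_act (s, MoveLeft) t = (\<lambda>i. (t(0 := s)) (i - 1))"
| "tape_act (s, Stay) t = t(0 := s)"
| "tape_act (s, MoveRight) t = (\<lambda>i. (t(0 := s)) (i + 1))"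

text \<open>
  The states are the numbers below \<open>num_states\<close>. The machine has \<open>num_tapes\<close> tapes, all of them
  readable and writable: tape \<open>0\<close> initially holds the input, tape \<open>1\<close> is the query tape, and tape \<open>2\<close>
  holds the output on halting. The transition function maps a state and the list of scanned symbols
  to the next state and, for each tape, the symbol to write and the head move.
\<close>

record oracle_tm =
  num_states :: nat
  num_tapes :: nat
  start_state :: nat
  halt_state :: nat
  query_state :: nat
  yes_state :: nat
  no_state :: nat
  delta :: "nat \<Rightarrow> bool option list \<Rightarrow> nat \<times> (bool option \<times> move) list"

definition wf_oracle_tm :: "oracle_tm \<Rightarrow> bool" where
  "wf_oracle_tm M \<longleftrightarrow>
     {start_state M, halt_state M, query_state M, yes_state M, no_state M} \<subseteq> {..<num_states M} \<and>
     distinct [halt_state M, query_state M, yes_state M, no_state M] \<and>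
     3 \<le> num_tapes M \<and>
     (\<forall>q<num_states M. \<forall>ss. length ss = num_tapes M \<longrightarrow>
        fst (delta M q ss) < num_states M \<and> length (snd (delta M q ss)) = num_tapes M)"

type_synonym config = "nat \<times> tape list"

text \<open>Input \<open>n\<close> is written in unary.\<close>

definition otm_init :: "oracle_tm \<Rightarrow> nat \<Rightarrow> config" where
  "otm_init M n =
     (start_state M, tape_of (replicate n True) # replicate (num_tapes M - 1) (tape_of []))"

definition otm_step :: "oracle_tm \<Rightarrow> bool list set \<Rightarrow> config \<Rightarrow> config" where
  "otm_step M A c = (case c of (q, ts) \<Rightarrow>
     if q = halt_state M then c
     else if q = query_state M then
       (if \<exists>w\<in>A. tape_string (ts ! 1) w then yes_state M else no_state M, ts)
     else (case delta M q (map (\<lambda>t. t 0) ts) of (q', as) \<Rightarrow> (q', map2 tape_act as ts)))"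

text \<open>\<open>otm_output M A n w\<close>: with oracle \<open>A\<close>, the machine \<open>M\<close> halts on input \<open>n\<close> with output \<open>w\<close>.\<close>

definition otm_output :: "oracle_tm \<Rightarrow> bool list set \<Rightarrow> nat \<Rightarrow> bool list \<Rightarrow> bool" where
  "otm_output M A n w \<longleftrightarrow>
     (\<exists>k q ts. (otm_step M A ^^ k) (otm_init M n) = (q, ts) \<and>
        q = halt_state M \<and> tape_string (ts ! 2) w)"

lemma tape_string_unique:
  assumes "tape_string t v" "tape_string t w"
  shows "v = w"
proof -
  have "length v = length w"
    using assms unfolding tape_string_def by (metis linorder_neqE_nat option.distinct(1))
  with assms show ?thesis
    unfolding tape_string_def by (metis nth_equalityI option.inject)
qed

lemma otm_output_unique:
  assumes "otm_output M A n v" "otm_output M A n w"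
  shows "v = w"
proof -
  have stay: "(otm_step M A ^^ j) (halt_state M, ts) = (halt_state M, ts)" for j ts
    by (induction j) (simp_all add: otm_step_def)
  have mono: "(otm_step M A ^^ l) (otm_init M n) = (halt_state M, ts)"
    if "(otm_step M A ^^ k) (otm_init M n) = (halt_state M, ts)" "k \<le> l" for k l ts
  proof -
    from that(2) obtain j where "l = j + k" by (metis add.commute le_Suc_ex)
    then show ?thesis using that(1) stay by (simp add: funpow_add)
  qed
  from assms obtain k l ts us where
      k: "(otm_step M A ^^ k) (otm_init M n) = (halt_state M, ts)" "tape_string (ts ! 2) v" and
      l: "(otm_step M A ^^ l) (otm_init M n) = (halt_state M, us)" "tape_string (us ! 2) w"
    unfolding otm_output_def by blast
  have "ts = us"
    using mono[OF k(1), of "max k l"] mono[OF l(1), of "max k l"] by simp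
  with k(2) l(2) show ?thesis using tape_string_unique by blast
qed

end

(* Since f is unbounded, one can compute n(k) with f (n(k)) > 2k. Put l(k) = n(k) - f (n(k)). The
   strings 1^k 0 w with |w| = l(k) form a prefix-free set, so there is a computer C that reads
   w as an l(k)-bit number and searches for a stage of the enumeration of rationals below alpha
   at which the fractional part reaches that number. On the correct w, the program has length
   k + 1 + l(k), so V produces the stage from a program of length at most
   k + 1 + l(k) + d <= n(k) as soon as k >= d. Knowing Dom V up to length n(k), the
   machine runs V on all these programs and obtains a bound on the stage, hence the first l(k) bits
   of alpha; c = 0 suffices.

   The oracle machine is obtained by compiling Kleene terms to programs working on stacks,
   the string on a tape being a stack whose top is the scanned cell. *)

theory Submission
  imports Defs
begin

section \<open>A small language of stack operations with an oracle instruction\<close>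

section \<open>Stack programs\<close>

text \<open>Two obstacles shape the construction: the machine model has one query state, and V is
  partial. All oracle access therefore goes through a single \<open>Ask\<close> in the body of one
  loop over the strings of length at most n; the answer becomes a unary number, and the rest is
  arithmetic done by Kleene terms. The answer also serves as the counter of a primitive recursion
  whose step runs V, so that V is evaluated only where it is defined.

  The machine never learns k, nor which program is the right one. It adds the codes of all outputs,
  and the sum T bounds the stage named by the right program. Every fraction of the enumeration is a
  lower bound, so searching all stages up to T cannot overshoot, and counting the positive multiples
  of 2^-l that these stages reach gives exactly the l-bit truncation of the fractional part. Wrong
  words w do no harm: on them C halts no later than on the correct one, or not at all.\<close>

datatype com =
    Push nat bool
  | Pop nat
  | Ask nat
  | Seq com com (infixr ";;" 60)
  | While nat com

type_synonym stacks = "nat \<Rightarrow> bool list"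

text \<open>Only terminating runs are related. \<open>Ask\<close> leaves its answer as data, adding
  0 or 1 in unary to a stack, so that a Kleene term can use it later without any branching on the
  answer.\<close>

inductive exec :: "bool list set \<Rightarrow> com \<Rightarrow> stacks \<Rightarrow> stacks \<Rightarrow> bool" for A where
  Push: "exec A (Push i b) s (s(i := b # s i))"
| Pop: "exec A (Pop i) s (s(i := tl (s i)))"
| Ask: "exec A (Ask i) s (if s 1 \<in> A then s(i := True # s i) else s)"
| Seq: "exec A c s s' \<Longrightarrow> exec A d s' s'' \<Longrightarrow> exec A (c ;; d) s s''"
| While_done: "s i = [] \<Longrightarrow> exec A (While i c) s s"
| While_step: "s i \<noteq> [] \<Longrightarrow> exec A c s s' \<Longrightarrow> exec A (While i c) s' s'' \<Longrightarrow> exec A (While i c) s s''"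

primrec asks :: "com \<Rightarrow> nat" where
  "asks (Push i b) = 0"
| "asks (Pop i) = 0"
| "asks (Ask i) = 1"
| "asks (c ;; d) = asks c + asks d"
| "asks (While i c) = asks c"

primrec stack_bound :: "com \<Rightarrow> nat" where
  "stack_bound (Push i b) = Suc i"
| "stack_bound (Pop i) = Suc i"
| "stack_bound (Ask i) = Suc i"
| "stack_bound (c ;; d) = max (stack_bound c) (stack_bound d)"
| "stack_bound (While i c) = max (Suc i) (stack_bound c)"

section \<open>Compilation to instructions with absolute jump targets\<close>

datatype instr = Op nat "bool option \<Rightarrow> (bool option \<times> move) \<times> nat" | Query

text \<open>
  \<open>code c e\<close> is entered at state \<open>e\<close> and left at the state following its last instruction. A machine
  writes before it moves, so a push takes two steps. \<open>Query\<close> continues at the next state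
  or at the one after it, according to the answer.
\<close>

primrec code :: "com \<Rightarrow> nat \<Rightarrow> instr list" where
  "code (Push i b) e =
     [Op i (\<lambda>x. ((x, MoveLeft), e + 1)), Op i (\<lambda>x. ((Some b, Stay), e + 2))]"
| "code (Pop i) e = [Op i (\<lambda>x. ((None, MoveRight), e + 1))]"
| "code (Ask i) e =
     [Query, Op i (\<lambda>x. ((x, MoveLeft), e + 3)), Op i (\<lambda>x. ((x, Stay), e + 4)),
      Op i (\<lambda>x. ((Some True, Stay), e + 4))]"
| "code (c ;; d) e = code c e @ code d (e + length (code c e))"
| "code (While i c) e =
     Op i (\<lambda>x. ((x, Stay), if x = None then e + length (code c (e + 1)) + 2 else e + 1)) #
     code c (e + 1) @ [Op i (\<lambda>x. ((x, Stay), e))]"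

lemma length_filter_code: "length (filter (\<lambda>x. x = Query) (code c e)) = asks c"
  by (induction c arbitrary: e) auto

text \<open>The three instructions after a \<open>Query\<close> belong to the same
  \<open>Ask\<close>. This keeps the yes and no states, the two addresses after the query state,
  below the halting state.\<close>

lemma code_Query_bound:
  "j < length (code c e) \<Longrightarrow> code c e ! j = Query \<Longrightarrow> j + 4 \<le> length (code c e)"
proof (induction c arbitrary: e j)
  case (Seq c d)
  show ?case
  proof (cases "j < length (code c e)")
    case True
    then show ?thesis using Seq.IH(1)[OF True] Seq.prems by (simp add: nth_append)
  next
    case False
    then have "j - length (code c e) + 4 \<le> length (code d (e + length (code c e)))"
      using Seq.prems by (intro Seq.IH(2)) (auto simp: nth_append)
    then show ?thesis using False by simp
  qed
next
  case (While i c)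
  then obtain j' where j: "j = Suc j'" by (cases j) auto
  then show ?case
    using While.IH[of j' "e + 1"] While.prems
    by (cases "j' < length (code c (Suc e))") (auto simp: nth_append nth_Cons')
qed (auto simp: less_Suc_eq nth_Cons')

text \<open>The halting state is the address just past the program, so running off the end halts.
  The \<open>min\<close> keeps every jump inside the state set whatever the instructions are, as
  \<open>wf_oracle_tm\<close> demands.\<close>

definition machine :: "instr list \<Rightarrow> nat \<Rightarrow> nat \<Rightarrow> oracle_tm" where
  "machine P Q k = \<lparr>num_states = Suc (length P), num_tapes = k, start_state = 0,
     halt_state = length P, query_state = Q, yes_state = Q + 1, no_state = Q + 2,
     delta = (\<lambda>q ss. let skip = map (\<lambda>x. (x, Stay)) ss in
       if q < length P then
         case P ! q of Op i \<phi> \<Rightarrow> (min (snd (\<phi> (ss ! i))) (length P), skip[i := fst (\<phi> (ss ! i))])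
         | Query \<Rightarrow> (0, skip)
       else (0, skip))\<rparr>"

lemma machine_simps [simp]:
  "num_tapes (machine P Q k) = k" "start_state (machine P Q k) = 0"
  "halt_state (machine P Q k) = length P" "query_state (machine P Q k) = Q"
  "yes_state (machine P Q k) = Q + 1" "no_state (machine P Q k) = Q + 2"
  by (simp_all add: machine_def)

lemma wf_machine: "Q + 3 \<le> length P \<Longrightarrow> 3 \<le> k \<Longrightarrow> wf_oracle_tm (machine P Q k)"
  by (auto simp: wf_oracle_tm_def machine_def Let_def split: instr.split)

definition reach :: "oracle_tm \<Rightarrow> bool list set \<Rightarrow> config \<Rightarrow> config \<Rightarrow> bool" where
  "reach M A c c' \<longleftrightarrow> (\<exists>n. (otm_step M A ^^ n) c = c')"

lemma reach_trans [trans]: "reach M A c c' \<Longrightarrow> reach M A c' c'' \<Longrightarrow> reach M A c c''"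
  unfolding reach_def by (metis funpow_add comp_apply)

lemma reach_step: "otm_step M A c = c' \<Longrightarrow> reach M A c c'"
  unfolding reach_def by (rule exI[of _ 1]) simp

lemma reach_Op:
  assumes "q < length P" "q \<noteq> Q" "P ! q = Op i \<phi>" "i < k" "length ts = k"
    and "snd (\<phi> ((ts ! i) 0)) = q'" "q' \<le> length P"
    and "ts' = ts[i := tape_act (fst (\<phi> ((ts ! i) 0))) (ts ! i)]"
  shows "reach (machine P Q k) A (q, ts) (q', ts')"
proof -
  have "map2 tape_act ((map (\<lambda>x. (x, Stay)) (map (\<lambda>t. t 0) ts))[i := a]) ts
          = ts[i := tape_act a (ts ! i)]" for a
    by (rule nth_equalityI) (use assms in \<open>auto simp: nth_list_update\<close>)
  then have "otm_step (machine P Q k) A (q, ts) = (q', ts')"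
    using assms by (simp add: otm_step_def machine_def Let_def comp_def)
  then show ?thesis by (rule reach_step)
qed

lemma reach_Query:
  "Q < length P \<Longrightarrow> reach (machine P Q k) A (Q, ts)
     (if \<exists>w\<in>A. tape_string (ts ! 1) w then Q + 1 else Q + 2, ts)"
  by (rule reach_step) (simp add: otm_step_def)

text \<open>All cells outside the strings are blank, including those left of the heads, so the tapes
  depend on the stacks alone. For this reason \<open>Pop\<close> erases the cell that it
  leaves.\<close>

definition tapes_of :: "nat \<Rightarrow> stacks \<Rightarrow> tape list" where
  "tapes_of k s = map (\<lambda>i. tape_of (s i)) [0..<k]"

lemma length_tapes_of [simp]: "length (tapes_of k s) = k"
  by (simp add: tapes_of_def)

lemma nth_tapes_of [simp]: "i < k \<Longrightarrow> tapes_of k s ! i = tape_of (s i)"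
  by (simp add: tapes_of_def)

lemma tapes_of_update: "(tapes_of k s)[i := tape_of w] = tapes_of k (s(i := w))"
  by (rule nth_equalityI) (auto simp: nth_list_update)

lemma tape_of_0: "tape_of w 0 = None \<longleftrightarrow> w = []"
  by (simp add: tape_of_def)

lemma tape_string_tape_of: "tape_string (tape_of w) v \<longleftrightarrow> v = w"
proof -
  have "tape_string (tape_of w) w"
    by (simp add: tape_string_def tape_of_def)
  then show ?thesis using tape_string_unique by blast
qed

lemma tape_act_push:
  "tape_act (Some b, Stay) (tape_act (tape_of w 0, MoveLeft) (tape_of w)) = tape_of (b # w)"
  by (auto simp: fun_eq_iff tape_of_def nth_Cons' nat_diff_distrib)

lemma tape_act_pop: "tape_act (None, MoveRight) (tape_of w) = tape_of (tl w)"
  by (cases w) (auto simp: fun_eq_iff tape_of_def nat_add_distrib)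

text \<open>Jumps are absolute, so \<open>c\<close> must be compiled for the address at which it
  sits. Arbitrary surrounding code \<open>xs\<close> and \<open>ys\<close> lets the induction
  descend to subprograms.\<close>

lemma code_correct:
  assumes "exec A c s s'"
    and "P = xs @ code c (length xs) @ ys"
    and "stack_bound c \<le> k" "1 < k"
    and Q: "\<And>j. j < length P \<Longrightarrow> P ! j = Query \<longleftrightarrow> j = Q"
  shows "reach (machine P Q k) A (length xs, tapes_of k s)
           (length xs + length (code c (length xs)), tapes_of k s')"
  using assms(1-3)
proof (induction arbitrary: xs ys)
  case (Push i b s)
  let ?e = "length xs" and ?M = "machine P Q k" and ?t = "tapes_of k s"
  let ?t1 = "?t[i := tape_act (tape_of (s i) 0, MoveLeft) (tape_of (s i))]"
  have len: "?e + 2 \<le> length P" using Push by simp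
  have P: "P ! ?e = Op i (\<lambda>x. ((x, MoveLeft), ?e + 1))"
    "P ! (?e + 1) = Op i (\<lambda>x. ((Some b, Stay), ?e + 2))"
    using Push by (simp_all add: nth_append)
  have i: "i < k" using Push by simp
  have nQ: "?e \<noteq> Q" "?e + 1 \<noteq> Q" using Q[of ?e] Q[of "?e + 1"] P len by auto
  have "reach ?M A (?e, ?t) (?e + 1, ?t1)"
    by (rule reach_Op[OF _ nQ(1) P(1) i]) (use len i in auto)
  also have "reach ?M A (?e + 1, ?t1) (?e + 2, tapes_of k (s(i := b # s i)))"
    by (rule reach_Op[OF _ nQ(2) P(2) i])
      (use len i in \<open>auto simp del: tape_act.simps simp: tape_act_push tapes_of_update\<close>)
  finally show ?case by (simp add: fun_upd_def)
next
  case (Pop i s)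
  let ?e = "length xs"
  have len: "?e + 1 \<le> length P" using Pop by simp
  have P: "P ! ?e = Op i (\<lambda>x. ((None, MoveRight), ?e + 1))"
    using Pop by (simp add: nth_append)
  have i: "i < k" using Pop by simp
  have nQ: "?e \<noteq> Q" using Q[of ?e] P len by auto
  have "reach (machine P Q k) A (?e, tapes_of k s) (?e + 1, tapes_of k (s(i := tl (s i))))"
    by (rule reach_Op[OF _ nQ P i])
      (use len i in \<open>auto simp del: tape_act.simps simp: tape_act_pop tapes_of_update\<close>)
  then show ?case by (simp add: fun_upd_def)
next
  case (Ask i s)
  let ?e = "length xs" and ?M = "machine P Q k" and ?t = "tapes_of k s"
  let ?t1 = "?t[i := tape_act (tape_of (s i) 0, MoveLeft) (tape_of (s i))]"
  have len4: "length (code (Ask i) ?e) = 4" by simp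
  have len: "?e + 4 \<le> length P" using Ask by simp
  \<comment> \<open>The yes and no states are adjacent, which leaves room for one instruction of the
    yes branch. It therefore jumps over the no branch to finish its two-step push at
    \<open>?e + 3\<close>.\<close>
  have P: "P ! ?e = Query" "P ! (?e + 1) = Op i (\<lambda>x. ((x, MoveLeft), ?e + 3))"
    "P ! (?e + 2) = Op i (\<lambda>x. ((x, Stay), ?e + 4))"
    "P ! (?e + 3) = Op i (\<lambda>x. ((Some True, Stay), ?e + 4))"
    using Ask by (simp_all add: nth_append)
  have i: "i < k" using Ask by simp
  have eQ: "?e = Q" using Q[of ?e] P len by auto
  have nQ: "?e + 1 \<noteq> Q" "?e + 2 \<noteq> Q" "?e + 3 \<noteq> Q" using eQ by auto
  have ask: "reach ?M A (?e, ?t) (if s 1 \<in> A then ?e + 1 else ?e + 2, ?t)"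
    using len eQ reach_Query[of Q P k A ?t] \<open>1 < k\<close> by (auto simp: tape_string_tape_of split: if_splits)
  show ?case
  proof (cases "s 1 \<in> A")
    case True
    then have "reach ?M A (?e, ?t) (?e + 1, ?t)" using ask by simp
    also have "reach ?M A (?e + 1, ?t) (?e + 3, ?t1)"
      by (rule reach_Op[OF _ nQ(1) P(2) i]) (use len i in auto)
    also have "reach ?M A (?e + 3, ?t1) (?e + 4, tapes_of k (s(i := True # s i)))"
      by (rule reach_Op[OF _ nQ(3) P(4) i])
        (use len i in \<open>auto simp del: tape_act.simps simp: tape_act_push tapes_of_update\<close>)
    finally show ?thesis using True by (simp add: len4 fun_upd_def del: code.simps)
  next
    case False
    then have "reach ?M A (?e, ?t) (?e + 2, ?t)" using ask by simp
    also have "reach ?M A (?e + 2, ?t) (?e + 4, ?t)"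
      by (rule reach_Op[OF _ nQ(2) P(3) i])
        (use len i in \<open>auto simp: tapes_of_update\<close>)
    finally show ?thesis using False by (simp add: len4 del: code.simps)
  qed
next
  case (Seq c s s' d s'')
  let ?l = "length (code c (length xs))"
  have "reach (machine P Q k) A (length xs, tapes_of k s) (length xs + ?l, tapes_of k s')"
    using Seq.IH(1)[of xs "code d (length xs + ?l) @ ys"] Seq.prems by simp
  also have "reach (machine P Q k) A \<dots>
      (length xs + ?l + length (code d (length xs + ?l)), tapes_of k s'')"
    using Seq.IH(2)[of "xs @ code c (length xs)" ys] Seq.prems by simp
  finally show ?case by (simp add: add.assoc)
next
  case (While_done s i c)
  let ?e = "length xs" and ?l = "length (code c (length xs + 1))"
  have len: "?e + ?l + 2 \<le> length P" using While_done by simp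
  have P: "P ! ?e = Op i (\<lambda>x. ((x, Stay), if x = None then ?e + ?l + 2 else ?e + 1))"
    using While_done by (simp add: nth_append)
  have i: "i < k" using While_done by simp
  have nQ: "?e \<noteq> Q" using Q[of ?e] P len by auto
  show ?case
    by (rule reach_Op[OF _ nQ P i])
      (use len i While_done in \<open>auto simp: tapes_of_update tape_of_0 fun_upd_idem\<close>)
next
  case (While_step s i c s' s'')
  let ?e = "length xs" and ?l = "length (code c (length xs + 1))" and ?M = "machine P Q k"
  let ?x = "Op i (\<lambda>x. ((x, Stay), if x = None then ?e + ?l + 2 else ?e + 1))"
  let ?y = "Op i (\<lambda>x. ((x, Stay), ?e))"
  have len: "?e + ?l + 2 \<le> length P" using While_step by simp
  have P: "P ! ?e = ?x" "P ! (?e + ?l + 1) = ?y"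
    using While_step by (simp_all add: nth_append)
  have i: "i < k" using While_step by simp
  have nQ: "?e \<noteq> Q" "?e + ?l + 1 \<noteq> Q" using Q[of ?e] Q[of "?e + ?l + 1"] P len by auto
  have "reach ?M A (?e, tapes_of k s) (?e + 1, tapes_of k s)"
    by (rule reach_Op[OF _ nQ(1) P(1) i])
      (use len i While_step in \<open>auto simp: tapes_of_update tape_of_0 fun_upd_idem\<close>)
  also have "reach ?M A (?e + 1, tapes_of k s) (?e + ?l + 1, tapes_of k s')"
    using While_step.IH(1)[of "xs @ [?x]" "?y # ys"] While_step.prems by simp
  also have "reach ?M A (?e + ?l + 1, tapes_of k s') (?e, tapes_of k s')"
    by (rule reach_Op[OF _ nQ(2) P(2) i])
      (use len i in \<open>auto simp: tapes_of_update\<close>)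
  also have "reach ?M A (?e, tapes_of k s') (?e + length (code (While i c) ?e), tapes_of k s'')"
    using While_step.IH(2)[of xs ys] While_step.prems by simp
  finally show ?case .
qed

text \<open>
  A machine has a single query state, whence the restriction to programs with a single \<open>Ask\<close>.
\<close>

theorem com_machine:
  assumes "asks c = 1"
  obtains M where "wf_oracle_tm M"
    and "\<And>A n s'. exec A c ((\<lambda>_. [])(0 := replicate n True)) s' \<Longrightarrow> otm_output M A n (s' 2)"
proof -
  define P where "P = code c 0"
  define k where "k = max 3 (stack_bound c)"
  have "card {j. j < length P \<and> P ! j = Query} = 1"
    using length_filter_code[of c 0] assms by (simp add: P_def length_filter_conv_card)
  then obtain Q where Q: "{j. j < length P \<and> P ! j = Query} = {Q}"
    by (rule card_1_singletonE)
  then have Q': "P ! j = Query \<longleftrightarrow> j = Q" if "j < length P" for j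
    using that by blast
  have "Q + 4 \<le> length P"
    using code_Query_bound[of Q c 0] Q unfolding P_def by blast
  then have "wf_oracle_tm (machine P Q k)"
    by (intro wf_machine) (auto simp: k_def)
  moreover have "otm_output (machine P Q k) A n (s' 2)"
    if e: "exec A c ((\<lambda>_. [])(0 := replicate n True)) s'" for A n s'
  proof -
    let ?s = "(\<lambda>_. [])(0 := replicate n True) :: stacks"
    have "reach (machine P Q k) A (length ([] :: instr list), tapes_of k ?s)
            (length ([] :: instr list) + length (code c (length ([] :: instr list))), tapes_of k s')"
      by (rule code_correct[OF e, where ys = "[]"]) (auto simp: P_def[symmetric] k_def Q')
    then have "reach (machine P Q k) A (0, tapes_of k ?s) (length P, tapes_of k s')"
      by (simp add: P_def)
    moreover have "otm_init (machine P Q k) n = (0, tapes_of k ?s)"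
    proof -
      have "tape_of (replicate n True) # replicate (k - 1) (tape_of []) = tapes_of k ?s"
        by (rule nth_equalityI) (auto simp: k_def nth_Cons')
      then show ?thesis by (simp add: otm_init_def)
    qed
    ultimately obtain t where
      "(otm_step (machine P Q k) A ^^ t) (otm_init (machine P Q k) n) = (length P, tapes_of k s')"
      unfolding reach_def by auto
    moreover have "tape_string (tapes_of k s' ! 2) (s' 2)"
      by (simp add: k_def tape_string_tape_of)
    ultimately show ?thesis
      unfolding otm_output_def by auto
  qed
  ultimately show ?thesis using that by blast
qed

section \<open>Kleene terms as programs on unary stacks\<close>

section \<open>Programs for partial recursive functions\<close>

abbreviation num :: "nat \<Rightarrow> bool list" where
  "num n \<equiv> replicate n True"

lemma exec_Push: "t = s(i := b # s i) \<Longrightarrow> exec A (Push i b) s t"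
  using exec.Push[of A i b s] by (simp add: fun_upd_def)

lemma exec_Pop: "t = s(i := tl (s i)) \<Longrightarrow> exec A (Pop i) s t"
  using exec.Pop[of A i s] by (simp add: fun_upd_def)

lemma exec_Ask: "t = s(i := (if s 1 \<in> A then [True] else []) @ s i) \<Longrightarrow> exec A (Ask i) s t"
  using exec.Ask[of A i s] by (cases "s 1 \<in> A") (simp_all add: fun_upd_def[of s i "True # s i"])

text \<open>The states are indexed by the iterations still to come, which is the height of the unary
  counter \<open>i\<close>.\<close>

lemma exec_loop:
  assumes "\<And>k. k < n \<Longrightarrow> exec A c (S (Suc k)) (S k)"
    and "\<And>k. k \<le> n \<Longrightarrow> S k i = num k"
  shows "exec A (While i c) (S n) (S 0)"
  using assms
proof (induction n)
  case 0
  then show ?case by (intro exec.While_done) simp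
next
  case (Suc n)
  have "exec A (While i c) (S n) (S 0)" using Suc by simp
  then show ?case
    using Suc.prems(2)[of "Suc n"] by (intro exec.While_step[OF _ Suc.prems(1)[of n]]) auto
qed

definition clear :: "nat \<Rightarrow> com" where
  "clear i = While i (Pop i)"

lemma exec_clear: "t = s(i := []) \<Longrightarrow> exec A (clear i) s t"
proof (induction "s i" arbitrary: s)
  case Nil
  then have "t = s" by (auto simp: fun_eq_iff)
  then show ?case using Nil by (auto simp: clear_def intro: exec.While_done)
next
  case (Cons x xs)
  have eq: "s i = x # xs" using Cons.hyps(2) by simp
  have "exec A (clear i) (s(i := tl (s i))) t"
    using Cons.prems eq by (intro Cons.hyps(1)) auto
  then show ?case
    unfolding clear_def using eq exec.While_step[OF _ exec_Pop[OF refl]] by simp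
qed

lemma asks_clear [simp]: "asks (clear i) = 0"
  by (simp add: clear_def)

text \<open>The stacks \<open>b\<close> and \<open>b + 1\<close> are scratch space; copying empties the source on the way.\<close>

definition copy :: "nat \<Rightarrow> nat \<Rightarrow> nat \<Rightarrow> com" where
  "copy b a d =
     While a (Pop a ;; Push b True ;; Push (b + 1) True) ;;
     While b (Pop b ;; Push a True) ;;
     clear d ;;
     While (b + 1) (Pop (b + 1) ;; Push d True)"

lemma exec_copy:
  assumes "a < b" "d < b" "s b = []" "s (b + 1) = []" "s a = num x" "t = s(d := num x)"
  shows "exec A (copy b a d) s t"
proof -
  have 1: "exec A (While a (Pop a ;; Push b True ;; Push (b + 1) True))
      s (s(a := [], b := num x, b + 1 := num x))"
  proof -
    define S where "S k = s(a := num k, b := num (x - k), b + 1 := num (x - k))" for k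
    have "exec A (While a (Pop a ;; Push b True ;; Push (b + 1) True)) (S x) (S 0)"
      by (rule exec_loop; (intro exec.Seq[OF exec_Pop[OF refl] exec.Seq[OF exec_Push[OF refl] exec_Push]])?)
        (use assms in \<open>auto simp: S_def fun_eq_iff Suc_diff_Suc simp flip: replicate_Suc\<close>)
    moreover have "S x = s" "S 0 = s(a := [], b := num x, b + 1 := num x)"
      using assms by (auto simp: S_def fun_eq_iff)
    ultimately show ?thesis by simp
  qed
  have 2: "exec A (While b (Pop b ;; Push a True))
      (s(a := [], b := num x, b + 1 := num x)) (s(b + 1 := num x))"
  proof -
    define S where "S k = s(a := num (x - k), b := num k, b + 1 := num x)" for k
    have "exec A (While b (Pop b ;; Push a True)) (S x) (S 0)"
      by (rule exec_loop; (intro exec.Seq[OF exec_Pop[OF refl] exec_Push])?)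
        (use assms in \<open>auto simp: S_def fun_eq_iff Suc_diff_Suc simp flip: replicate_Suc\<close>)
    moreover have "S x = s(a := [], b := num x, b + 1 := num x)" "S 0 = s(b + 1 := num x)"
      using assms by (auto simp: S_def fun_eq_iff)
    ultimately show ?thesis by simp
  qed
  have 3: "exec A (While (b + 1) (Pop (b + 1) ;; Push d True)) (s(d := [], b + 1 := num x)) t"
  proof -
    define S where "S k = s(d := num (x - k), b + 1 := num k)" for k
    have "exec A (While (b + 1) (Pop (b + 1) ;; Push d True)) (S x) (S 0)"
      by (rule exec_loop; (intro exec.Seq[OF exec_Pop[OF refl] exec_Push])?)
        (use assms in \<open>auto simp: S_def fun_eq_iff Suc_diff_Suc simp flip: replicate_Suc\<close>)
    moreover have "S x = s(d := [], b + 1 := num x)" "S 0 = t"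
      using assms by (auto simp: S_def fun_eq_iff)
    ultimately show ?thesis by simp
  qed
  show ?thesis
    unfolding copy_def
    by (rule exec.Seq[OF 1 exec.Seq[OF 2 exec.Seq[OF exec_clear 3]]])
      (use assms in \<open>auto simp: fun_eq_iff\<close>)
qed

lemma asks_copy [simp]: "asks (copy b a d) = 0"
  by (simp add: copy_def)

text \<open>
  In \<open>assigns b c r as d\<close>, the stacks from \<open>b\<close> on are scratch space, empty before and after the
  run; \<open>d\<close> may occur in \<open>as\<close>.
\<close>

definition assigns :: "nat \<Rightarrow> com \<Rightarrow> recf \<Rightarrow> nat list \<Rightarrow> nat \<Rightarrow> bool" where
  "assigns b c r as d \<longleftrightarrow> asks c = 0 \<and>
     (\<forall>A s xs v. (\<forall>j\<ge>b. s j = []) \<longrightarrow> map s as = map num xs \<longrightarrow> reval r xs = Some v \<longrightarrow>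
        exec A c s (s(d := num v)))"

lemma assignsI:
  assumes "asks c = 0"
    and "\<And>A s xs v. (\<And>j. b \<le> j \<Longrightarrow> s j = []) \<Longrightarrow> map s as = map num xs \<Longrightarrow> reval r xs = Some v \<Longrightarrow>
      exec A c s (s(d := num v))"
  shows "assigns b c r as d"
  using assms unfolding assigns_def by blast

lemma assigns_exec:
  assumes "assigns b c r as d" "\<And>j. b \<le> j \<Longrightarrow> s j = []" "map s as = map num xs"
    "reval r xs = Some v" "t = s(d := num v)"
  shows "exec A c s t"
  using assms unfolding assigns_def by blast

lemma assigns_Comp:
  assumes g: "\<And>g as b d. g \<in> set gs \<Longrightarrow> set as \<subseteq> {..<b} \<Longrightarrow> d < b \<Longrightarrow> \<exists>c. assigns b c g as d"
    and h: "\<And>as b d. set as \<subseteq> {..<b} \<Longrightarrow> d < b \<Longrightarrow> \<exists>c. assigns b c h as d"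
    and as: "set as \<subseteq> {..<b}" and d: "d < b"
  shows "\<exists>c. assigns b c (Comp h gs) as d"
proof -
  \<comment> \<open>The values of \<open>gs\<close> are laid out on the stacks from \<open>b\<close>
    on. Induction from the right appends each new value after the earlier ones, and the arguments,
    lying below \<open>b\<close>, survive.\<close>
  have "\<exists>c. asks c = 0 \<and> (\<forall>A s xs vs. (\<forall>j\<ge>b. s j = []) \<longrightarrow> map s as = map num xs \<longrightarrow>
          map (\<lambda>g. reval g xs) gs = map Some vs \<longrightarrow>
          exec A c s (\<lambda>i. if b \<le> i \<and> i < b + length gs then num (vs ! (i - b)) else s i))"
    using g
  proof (induction gs rule: rev_induct)
    case Nil
    \<comment> \<open>The language has no skip; clearing the empty stack \<open>b\<close> does
      nothing.\<close>
    show ?case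
      by (intro exI[of _ "clear b"] conjI allI impI exec_clear) (auto simp: fun_eq_iff)
  next
    case (snoc g gs)
    let ?l = "length gs"
    obtain c where c: "asks c = 0" "\<And>A s xs vs. \<forall>j\<ge>b. s j = [] \<Longrightarrow> map s as = map num xs \<Longrightarrow>
          map (\<lambda>g. reval g xs) gs = map Some vs \<Longrightarrow>
          exec A c s (\<lambda>i. if b \<le> i \<and> i < b + ?l then num (vs ! (i - b)) else s i)"
      using snoc.IH[OF snoc.prems] by auto
    obtain c' where c': "assigns (b + ?l + 1) c' g as (b + ?l)"
      using snoc.prems[of g as "b + ?l + 1" "b + ?l"] as by fastforce
    have "exec A (c ;; c') s (\<lambda>i. if b \<le> i \<and> i < b + length (gs @ [g]) then num (vs ! (i - b)) else s i)"
      if s: "\<forall>j\<ge>b. s j = []" "map s as = map num xs"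
        and vs: "map (\<lambda>g. reval g xs) (gs @ [g]) = map Some vs" for A s xs vs
    proof -
      obtain ws w where w: "vs = ws @ [w]" "map (\<lambda>g. reval g xs) gs = map Some ws" "reval g xs = Some w"
        using vs by (cases vs rule: rev_cases) auto
      have l: "length ws = ?l" using arg_cong[OF w(2), of length] by simp
      let ?s = "\<lambda>i. if b \<le> i \<and> i < b + ?l then num (ws ! (i - b)) else s i"
      have "map ?s as = map num xs"
        unfolding s(2)[symmetric] using as by (auto simp: not_le)
      then show ?thesis
        by (intro exec.Seq[OF c(2)[OF s w(2)]] assigns_exec[OF c' _ _ w(3)])
          (use s l in \<open>auto simp: w(1) fun_eq_iff nth_append\<close>)
    qed
    then show ?case
      using c(1) c' by (intro exI[of _ "c ;; c'"]) (auto simp: assigns_def)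
  qed
  then obtain c where c: "asks c = 0" "\<And>A s xs vs. \<forall>j\<ge>b. s j = [] \<Longrightarrow> map s as = map num xs \<Longrightarrow>
          map (\<lambda>g. reval g xs) gs = map Some vs \<Longrightarrow>
          exec A c s (\<lambda>i. if b \<le> i \<and> i < b + length gs then num (vs ! (i - b)) else s i)"
    by auto
  have "\<exists>c. asks c = 0 \<and> (\<forall>A s. exec A c s (\<lambda>i. if b \<le> i \<and> i < b + l \<or> i = b then [] else s i))" for l
  proof (induction l)
    case 0
    have "exec A (clear b) s (\<lambda>i. if b \<le> i \<and> i < b + 0 \<or> i = b then [] else s i)" for A s
      by (rule exec_clear) auto
    then show ?case by (intro exI[of _ "clear b"]) auto
  next
    case (Suc l)
    then obtain c where c: "asks c = 0"
      "\<And>A s. exec A c s (\<lambda>i. if b \<le> i \<and> i < b + l \<or> i = b then [] else s i)"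
      by auto
    have "exec A (c ;; clear (b + l)) s (\<lambda>i. if b \<le> i \<and> i < b + Suc l \<or> i = b then [] else s i)" for A s
      by (rule exec.Seq[OF c(2) exec_clear]) (auto simp: fun_eq_iff)
    then show ?case using c(1) by (intro exI[of _ "c ;; clear (b + l)"]) auto
  qed
  then obtain e where e: "asks e = 0"
    "\<And>A s. exec A e s (\<lambda>i. if b \<le> i \<and> i < b + length gs \<or> i = b then [] else s i)"
    by blast
  obtain c' where c': "assigns (b + length gs) c' h [b..<b + length gs] d"
    using h[of "[b..<b + length gs]" "b + length gs" d] d by fastforce
  have "assigns b (c ;; c' ;; e) (Comp h gs) as d"
  proof (rule assignsI)
    show "asks (c ;; c' ;; e) = 0"
      using c(1) c' e(1) by (simp add: assigns_def)
  next
    fix A s xs v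
    assume s: "\<And>j. b \<le> j \<Longrightarrow> s j = []" "map s as = map num xs" and r: "reval (Comp h gs) xs = Some v"
    define vs where "vs = map (\<lambda>g. the (reval g xs)) gs"
    have vs: "map (\<lambda>g. reval g xs) gs = map Some vs" "reval h vs = Some v"
      using r by (auto simp: vs_def Let_def comp_def image_iff split: if_splits)
    let ?s = "\<lambda>i. if b \<le> i \<and> i < b + length gs then num (vs ! (i - b)) else s i"
    have "map ?s [b..<b + length gs] = map num vs"
      by (rule nth_equalityI) (auto simp: vs_def)
    then show "exec A (c ;; c' ;; e) s (s(d := num v))"
    proof (intro exec.Seq[OF c(2)[OF _ s(2) vs(1)]] exec.Seq)
      show "exec A c' ?s (?s(d := num v))"
        using s \<open>map ?s _ = _\<close> by (intro assigns_exec[OF c' _ _ vs(2)]) auto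
      have "(\<lambda>i. if b \<le> i \<and> i < b + length gs \<or> i = b then [] else (?s(d := num v)) i) = s(d := num v)"
        using s d by (auto simp: fun_eq_iff)
      then show "exec A e (?s(d := num v)) (s(d := num v))"
        using e(2)[of A "?s(d := num v)"] by simp
    qed (use s in auto)
  qed
  then show ?thesis by blast
qed

lemma assigns_PrimRec:
  assumes g: "\<And>as b d. set as \<subseteq> {..<b} \<Longrightarrow> d < b \<Longrightarrow> \<exists>c. assigns b c g as d"
    and h: "\<And>as b d. set as \<subseteq> {..<b} \<Longrightarrow> d < b \<Longrightarrow> \<exists>c. assigns b c h as d"
    and as: "set as \<subseteq> {..<b}" and d: "d < b"
  shows "\<exists>c. assigns b c (PrimRec g h) as d"
proof (cases as)
  case Nil
  \<comment> \<open>On an empty argument list the term is undefined, so any program without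
    \<open>Ask\<close> will do.\<close>
  have "assigns b (Pop 0) (PrimRec g h) as d"
    by (rule assignsI) (simp_all add: Nil)
  then show ?thesis by blast
next
  case (Cons a as')
  obtain cg where cg: "assigns (b + 3) cg g as' (b + 1)"
    using g[of as' "b + 3" "b + 1"] as Cons by fastforce
  obtain ch where ch: "assigns (b + 3) ch h (b # (b + 1) # as') (b + 1)"
    using h[of "b # (b + 1) # as'" "b + 3" "b + 1"] as Cons by fastforce
  \<comment> \<open>Stack \<open>b\<close> counts the completed steps, \<open>b + 1\<close> holds
    the value after them, and \<open>b + 2\<close> holds the number of steps still to do.\<close>
  define body where "body = Pop (b + 2) ;; ch ;; Push b True"
  define c where "c = copy (b + 3) a (b + 2) ;; cg ;; While (b + 2) body ;;
    copy (b + 3) (b + 1) d ;; clear b ;; clear (b + 1)"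
  have "assigns b c (PrimRec g h) as d"
  proof (rule assignsI)
    show "asks c = 0"
      using cg ch by (simp add: assigns_def c_def body_def)
  next
    fix A s xs v
    assume s: "\<And>j. b \<le> j \<Longrightarrow> s j = []" and xs: "map s as = map num xs"
      and r: "reval (PrimRec g h) xs = Some v"
    from xs obtain n ys where n: "xs = n # ys" "s a = num n" "map s as' = map num ys"
      using Cons by (cases xs) auto
    define R where "R = rec_nat (reval g ys)
      (\<lambda>m r. case r of None \<Rightarrow> None | Some v \<Rightarrow> reval h (m # v # ys))"
    have R0: "R 0 = reval g ys" and RSuc: "R (Suc m) = (case R m of None \<Rightarrow> None | Some v \<Rightarrow> reval h (m # v # ys))" for m
      by (simp_all add: R_def)
    have Rn: "R n = Some v" using r n by (simp add: R_def)
    \<comment> \<open>\<open>None\<close> propagates upwards, so a value at \<open>n\<close> forces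
      values at all earlier steps.\<close>
    have R_some: "R m \<noteq> None" if "m \<le> n" for m
      using that
    proof (induction rule: inc_induct)
      case (step m)
      then show ?case by (auto simp: RSuc split: option.splits)
    qed (simp add: Rn)
    define w where "w m = the (R m)" for m
    have w: "R m = Some (w m)" if "m \<le> n" for m
      using R_some[OF that] by (simp add: w_def)
    have wh: "reval h (m # w m # ys) = Some (w (Suc m))" if "m < n" for m
      using w[of m] w[of "Suc m"] that by (simp add: RSuc)
    define S where "S k = s(b := num (n - k), b + 1 := num (w (n - k)), b + 2 := num k)" for k
    have as': "a < b" "set as' \<subseteq> {..<b}" using as Cons by auto
    have args: "map t (b # (b + 1) # as') = map num (p # q # ys)"
      if "t = s(b := num p, b + 1 := num q, b + 2 := num k)" for t p q k
    proof -
      have "map t as' = map s as'" using that as'(2) by (intro map_cong) auto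
      then show ?thesis using that n(3) by simp
    qed
    have loop: "exec A (While (b + 2) body) (S n) (S 0)"
    proof (rule exec_loop)
      fix k assume k: "k < n"
      let ?m = "n - Suc k"
      have km: "n - k = Suc ?m" using k by simp
      have hm: "reval h (?m # w ?m # ys) = Some (w (Suc ?m))" using wh[of ?m] k by simp
      show "exec A body (S (Suc k)) (S k)"
        unfolding body_def
        by (intro exec.Seq[OF exec_Pop exec.Seq[OF assigns_exec[OF ch _ args[OF refl, of _ _ k] hm refl] exec_Push]])
          (use s in \<open>auto simp: S_def fun_eq_iff km\<close>)
    qed (simp add: S_def)
    have 0: "reval g ys = Some (w 0)" using w[of 0] R0 by simp
    have wn: "w n = v" using w[of n] Rn by simp
    have "exec A (copy (b + 3) a (b + 2)) s (s(b + 2 := num n))"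
      by (rule exec_copy) (use s n as' in auto)
    moreover have "exec A cg (s(b + 2 := num n)) (S n)"
    proof (rule assigns_exec[OF cg _ _ 0])
      show "map (s(b + 2 := num n)) as' = map num ys"
        unfolding n(3)[symmetric] using as'(2) by (intro map_cong) auto
    qed (use s in \<open>auto simp: S_def fun_eq_iff\<close>)
    moreover have "exec A (copy (b + 3) (b + 1) d) (S 0) ((S 0)(d := num v))"
      by (rule exec_copy) (use s wn d in \<open>auto simp: S_def\<close>)
    moreover have "exec A (clear b ;; clear (b + 1)) ((S 0)(d := num v)) (s(d := num v))"
      by (rule exec.Seq[OF exec_clear[OF refl] exec_clear]) (use s d in \<open>auto simp: S_def fun_eq_iff\<close>)
    ultimately show "exec A c s (s(d := num v))"
      unfolding c_def using loop by (blast intro: exec.Seq)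
  qed
  then show ?thesis by blast
qed

lemma assigns_Mu:
  assumes h: "\<And>as b d. set as \<subseteq> {..<b} \<Longrightarrow> d < b \<Longrightarrow> \<exists>c. assigns b c h as d"
    and as: "set as \<subseteq> {..<b}" and d: "d < b"
  shows "\<exists>c. assigns b c (Mu h) as d"
proof -
  obtain ch where ch: "assigns (b + 2) ch h (b # as) (b + 1)"
    using h[of "b # as" "b + 2" "b + 1"] as by fastforce
  \<comment> \<open>Stack \<open>b\<close> is the candidate and \<open>b + 1\<close> the value of
    \<open>h\<close> there. The loop ends when that value is 0, so \<open>b + 1\<close> is already
    empty at the end.\<close>
  define body where "body = Push b True ;; ch"
  define c where "c = ch ;; While (b + 1) body ;; copy (b + 2) b d ;; clear b"
  have "assigns b c (Mu h) as d"
  proof (rule assignsI)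
    show "asks c = 0"
      using ch by (simp add: assigns_def c_def body_def)
  next
    fix A s xs v
    assume s: "\<And>j. b \<le> j \<Longrightarrow> s j = []" and xs: "map s as = map num xs"
      and r: "reval (Mu h) xs = Some v"
    from r obtain z where z: "reval h (z # xs) = Some 0" "\<And>y. y < z \<Longrightarrow> \<exists>v. reval h (y # xs) = Some (Suc v)"
      and v: "v = (LEAST z. reval h (z # xs) = Some 0)"
      by (auto split: if_splits)
    have "v = z"
      unfolding v
    proof (rule Least_equality)
      show "z \<le> y" if "reval h (y # xs) = Some 0" for y
        using that z(2)[of y] by (cases "y < z") auto
    qed (rule z(1))
    define w where "w y = the (reval h (y # xs))" for y
    have w: "reval h (y # xs) = Some (w y)" if "y \<le> z" for y
      using that z(1) z(2)[of y] by (cases "y = z") (auto simp: w_def)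
    have w0: "w y \<noteq> 0 \<longleftrightarrow> y < z" if "y \<le> z" for y
      using that z(1) z(2)[of y] by (cases "y = z") (auto simp: w_def)
    define S where "S y = s(b := num y, b + 1 := num (w y))" for y
    have loop: "exec A (While (b + 1) body) (S y) (S z)" if "y \<le> z" for y
      using that
    proof (induction rule: inc_induct)
      case base
      show ?case by (rule exec.While_done) (use w0[of z] in \<open>simp add: S_def\<close>)
    next
      case (step y)
      have "exec A body (S y) (S (Suc y))"
        unfolding body_def
        by (intro exec.Seq[OF exec_Push[OF refl] assigns_exec[OF ch _ _ w[of "Suc y"]]])
          (use s as step in \<open>auto simp: S_def fun_eq_iff xs[symmetric]\<close>)
      moreover have "S y (b + 1) \<noteq> []"
        using w0[of y] step by (simp add: S_def)
      ultimately show ?case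
        using exec.While_step step.IH by blast
    qed
    have "exec A ch s (S 0)"
      by (intro assigns_exec[OF ch _ _ w[of 0]]) (use s xs as in \<open>auto simp: S_def fun_eq_iff\<close>)
    moreover have "exec A (copy (b + 2) b d) (S z) ((S z)(d := num v))"
      by (rule exec_copy) (use s d \<open>v = z\<close> in \<open>auto simp: S_def\<close>)
    moreover have "exec A (clear b) ((S z)(d := num v)) (s(d := num v))"
      by (rule exec_clear) (use s d w0[of z] in \<open>auto simp: S_def fun_eq_iff\<close>)
    ultimately show "exec A c s (s(d := num v))"
      unfolding c_def using loop[of 0] by (blast intro: exec.Seq)
  qed
  then show ?thesis by blast
qed

theorem recf_program:
  "set as \<subseteq> {..<b} \<Longrightarrow> d < b \<Longrightarrow> \<exists>c. assigns b c r as d"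
proof (induction r arbitrary: as b d)
  case Zero
  have "assigns b (clear d) Zero as d"
    by (rule assignsI) (auto intro: exec_clear)
  then show ?case by blast
next
  case Succ
  have "assigns b (copy b (hd as) d ;; Push d True) Succ as d"
  proof (rule assignsI)
    fix A s xs v
    assume s: "\<And>j. b \<le> j \<Longrightarrow> s j = []" "map s as = map num xs" and r: "reval Succ xs = Some v"
    then obtain x ys a as' where x: "xs = x # ys" "v = Suc x" "as = a # as'"
      by (cases xs; cases as) auto
    show "exec A (copy b (hd as) d ;; Push d True) s (s(d := num v))"
      by (rule exec.Seq[OF exec_copy[OF _ _ _ _ _ refl] exec_Push]) (use s x Succ in auto)
  qed simp
  then show ?case by blast
next
  case (Proj i)
  have "assigns b (copy b (as ! i) d) (Proj i) as d"
  proof (rule assignsI)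
    fix A s xs v
    assume s: "\<And>j. b \<le> j \<Longrightarrow> s j = []" "map s as = map num xs" and r: "reval (Proj i) xs = Some v"
    then have i: "i < length xs" "v = xs ! i" "length as = length xs"
      by (auto split: if_splits dest: map_eq_imp_length_eq)
    have "s (as ! i) = num v"
      using i arg_cong[OF s(2), of "\<lambda>l. l ! i"] by simp
    moreover have "as ! i < b" using Proj i by (metis lessThan_iff nth_mem subsetD)
    ultimately show "exec A (copy b (as ! i) d) s (s(d := num v))"
      by (intro exec_copy) (use s Proj in auto)
  qed simp
  then show ?case by blast
next
  case (Comp h gs)
  show ?case by (rule assigns_Comp) (use Comp in auto)
next
  case (PrimRec g h)
  show ?case by (rule assigns_PrimRec) (use PrimRec in auto)
next
  case (Mu h)
  show ?case by (rule assigns_Mu) (use Mu in auto)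
qed

section \<open>Recursive arithmetic, bounded quantifiers and minimization\<close>

section \<open>Closure properties of the recursive functions\<close>

definition computable :: "nat \<Rightarrow> (nat list \<Rightarrow> nat) \<Rightarrow> bool" where
  "computable k F \<longleftrightarrow> (\<exists>r. \<forall>xs. length xs = k \<longrightarrow> reval r xs = Some (F xs))"

definition decidable :: "nat \<Rightarrow> (nat list \<Rightarrow> bool) \<Rightarrow> bool" where
  "decidable k P \<longleftrightarrow> computable k (\<lambda>xs. of_bool (P xs))"

lemma computable_cong:
  "(\<And>xs. length xs = k \<Longrightarrow> F xs = G xs) \<Longrightarrow> computable k F \<longleftrightarrow> computable k G"
  by (simp add: computable_def)

lemma computable_nth: "i < k \<Longrightarrow> computable k (\<lambda>xs. xs ! i)"
  unfolding computable_def by (rule exI[of _ "Proj i"]) simp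

lemma computable_compose:
  assumes "computable (length Fs) G" "\<And>F. F \<in> set Fs \<Longrightarrow> computable k F"
  shows "computable k (\<lambda>xs. G (map (\<lambda>F. F xs) Fs))"
proof -
  obtain g where g: "\<And>ys. length ys = length Fs \<Longrightarrow> reval g ys = Some (G ys)"
    using assms(1) unfolding computable_def by blast
  obtain r where r: "\<And>F xs. F \<in> set Fs \<Longrightarrow> length xs = k \<Longrightarrow> reval (r F) xs = Some (F xs)"
    using assms(2) unfolding computable_def by metis
  have "reval (Comp g (map r Fs)) xs = Some (G (map (\<lambda>F. F xs) Fs))" if "length xs = k" for xs
  proof -
    have "map (\<lambda>r. reval r xs) (map r Fs) = map Some (map (\<lambda>F. F xs) Fs)"
      using r[OF _ that] by simp
    moreover have "map the (map Some ys) = ys" for ys :: "nat list"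
      by (induction ys) auto
    ultimately show ?thesis
      using g[of "map (\<lambda>F. F xs) Fs"] by (simp only: reval.simps Let_def) auto
  qed
  then show ?thesis unfolding computable_def by blast
qed

lemma computable_apply:
  "computable 1 (\<lambda>xs. g (xs ! 0)) \<Longrightarrow> computable k F \<Longrightarrow> computable k (\<lambda>xs. g (F xs))"
  using computable_compose[of "[F]" "\<lambda>xs. g (xs ! 0)" k] by simp

lemma computable_Suc: "computable k F \<Longrightarrow> computable k (\<lambda>xs. Suc (F xs))"
proof (rule computable_apply[of Suc])
  show "computable 1 (\<lambda>xs. Suc (xs ! 0))"
    unfolding computable_def by (rule exI[of _ Succ]) (auto simp: length_Suc_conv)
qed

lemma computable_const: "computable k (\<lambda>xs. c)"
proof (induction c)
  case 0
  show ?case unfolding computable_def by (rule exI[of _ Zero]) simp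
qed (rule computable_Suc)

lemma computable_drop: "computable k F \<Longrightarrow> computable (j + k) (\<lambda>ys. F (drop j ys))"
proof -
  assume F: "computable k F"
  let ?Fs = "map (\<lambda>i ys. ys ! i) [j..<j + k]"
  have "computable (j + k) (\<lambda>ys. F (map (\<lambda>G. G ys) ?Fs))"
    by (rule computable_compose) (use F in \<open>auto intro: computable_nth\<close>)
  moreover have "map (\<lambda>G. G ys) ?Fs = drop j ys" if "length ys = j + k" for ys :: "nat list"
    by (rule nth_equalityI) (use that in auto)
  ultimately show ?thesis
    by (subst computable_cong[where G = "\<lambda>ys. F (map (\<lambda>G. G ys) ?Fs)"]) simp_all
qed

lemma computable_tl: "computable k F \<Longrightarrow> computable (Suc k) (\<lambda>ys. F (tl ys))"
  using computable_drop[of k F 1] by (simp add: drop_Suc)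

lemma computable_rec_nat:
  assumes "computable k N" "computable k G"
    and "computable (Suc (Suc k)) (\<lambda>ys. H (ys ! 0) (ys ! 1) (drop 2 ys))"
  shows "computable k (\<lambda>xs. rec_nat (G xs) (\<lambda>m r. H m r xs) (N xs))"
proof -
  obtain g where g: "\<And>ys. length ys = k \<Longrightarrow> reval g ys = Some (G ys)"
    using assms(2) unfolding computable_def by blast
  obtain h where h: "\<And>ys. length ys = Suc (Suc k) \<Longrightarrow> reval h ys = Some (H (ys ! 0) (ys ! 1) (drop 2 ys))"
    using assms(3) unfolding computable_def by blast
  have "reval (PrimRec g h) (n # xs) = Some (rec_nat (G xs) (\<lambda>m r. H m r xs) n)"
    if "length xs = k" for n xs
    by (induction n) (use that g h in auto)
  then have "computable (Suc k) (\<lambda>ys. rec_nat (G (tl ys)) (\<lambda>m r. H m r (tl ys)) (hd ys))"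
    unfolding computable_def by (intro exI[of _ "PrimRec g h"]) (auto simp: length_Suc_conv)
  then have "computable k (\<lambda>xs. (\<lambda>ys. rec_nat (G (tl ys)) (\<lambda>m r. H m r (tl ys)) (hd ys))
      (map (\<lambda>F. F xs) (N # map (\<lambda>i xs. xs ! i) [0..<k])))"
    by (intro computable_compose) (use assms(1) in \<open>auto intro: computable_nth\<close>)
  moreover have "map (\<lambda>F. F xs) (N # map (\<lambda>i xs. xs ! i) [0..<k]) = N xs # xs"
    if "length xs = k" for xs :: "nat list"
    using map_nth[of xs] that by (simp add: comp_def)
  ultimately show ?thesis
    by (subst (asm) computable_cong[where G = "\<lambda>xs. rec_nat (G xs) (\<lambda>m r. H m r xs) (N xs)"])
      simp_all
qed

lemma computable_add:
  assumes "computable k F" "computable k G"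
  shows "computable k (\<lambda>xs. F xs + G xs)"
proof -
  have "computable k (\<lambda>xs. rec_nat (F xs) (\<lambda>m r. Suc r) (G xs))"
    by (intro computable_rec_nat computable_Suc computable_nth assms) simp
  moreover have "rec_nat x (\<lambda>m r. Suc r) n = x + n" for x n :: nat
    by (induction n) auto
  ultimately show ?thesis by simp
qed

lemma computable_diff:
  assumes "computable k F" "computable k G"
  shows "computable k (\<lambda>xs. F xs - G xs)"
proof -
  have pred: "computable k' (\<lambda>xs. F xs - 1)" if "computable k' F" for k' F
  proof -
    have "computable k' (\<lambda>xs. rec_nat 0 (\<lambda>m r. m) (F xs))"
      by (intro computable_rec_nat computable_const computable_nth that) simp
    moreover have "rec_nat 0 (\<lambda>m r. m) n = n - 1" for n :: nat
      by (cases n) auto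
    ultimately show ?thesis by simp
  qed
  have "computable k (\<lambda>xs. rec_nat (F xs) (\<lambda>m r. r - 1) (G xs))"
    by (intro computable_rec_nat pred computable_nth assms) simp
  moreover have "rec_nat x (\<lambda>m r. r - 1) n = x - n" for x n :: nat
    by (induction n) auto
  ultimately show ?thesis by simp
qed

lemma computable_sum:
  assumes "computable k N" "computable (Suc k) (\<lambda>ys. H (hd ys) (tl ys))"
  shows "computable k (\<lambda>xs. \<Sum>i<N xs. H i xs)"
proof -
  \<comment> \<open>The step of the recursion also receives the accumulator, at position 1; these
    projections leave it out.\<close>
  let ?Fs = "(\<lambda>ys. ys ! 0) # map (\<lambda>i ys. ys ! i) [2..<Suc (Suc k)]"
  have "computable (Suc (Suc k)) (\<lambda>ys. (\<lambda>ys. H (hd ys) (tl ys)) (map (\<lambda>F. F ys) ?Fs))"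
  proof (rule computable_compose)
    have "length ?Fs = Suc k" by (simp del: upt_Suc)
    then show "computable (length ?Fs) (\<lambda>ys. H (hd ys) (tl ys))" using assms(2) by simp
  qed (auto intro: computable_nth)
  moreover have "map (\<lambda>F. F ys) ?Fs = ys ! 0 # drop 2 ys" if "length ys = Suc (Suc k)"
    for ys :: "nat list"
    by (rule nth_equalityI) (use that in \<open>auto simp: nth_Cons' simp del: upt_Suc\<close>)
  ultimately have "computable (Suc (Suc k)) (\<lambda>ys. H (ys ! 0) (drop 2 ys))"
    by (subst (asm) computable_cong[where G = "\<lambda>ys. H (ys ! 0) (drop 2 ys)"]) simp_all
  then have "computable k (\<lambda>xs. rec_nat 0 (\<lambda>m r. r + H m xs) (N xs))"
    by (intro computable_rec_nat computable_const computable_add computable_nth assms(1)) simp_all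
  moreover have "rec_nat 0 (\<lambda>m r. r + H m xs) n = (\<Sum>i<n. H i xs)" for n xs
    by (induction n) auto
  ultimately show ?thesis by simp
qed

lemma computable_mult:
  assumes "computable k F" "computable k G"
  shows "computable k (\<lambda>xs. F xs * G xs)"
proof -
  have "computable k (\<lambda>xs. \<Sum>i<F xs. G xs)"
    by (intro computable_sum computable_tl assms)
  then show ?thesis by simp
qed

lemma computable_power2:
  assumes "computable k F"
  shows "computable k (\<lambda>xs. 2 ^ F xs)"
proof -
  have "computable k (\<lambda>xs. rec_nat 1 (\<lambda>m r. r + r) (F xs))"
    by (intro computable_rec_nat computable_add computable_const computable_nth assms) simp_all
  moreover have "rec_nat 1 (\<lambda>m r. r + r) n = (2 ^ n :: nat)" for n
    by (induction n) auto
  ultimately show ?thesis by simp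
qed

lemma decidable_le: "computable k F \<Longrightarrow> computable k G \<Longrightarrow> decidable k (\<lambda>xs. F xs \<le> G xs)"
proof -
  assume "computable k F" "computable k G"
  then have "computable k (\<lambda>xs. 1 - (F xs - G xs))"
    by (intro computable_diff computable_const)
  moreover have "1 - (F xs - G xs) = of_bool (F xs \<le> G xs)" for xs by simp
  ultimately show ?thesis by (simp add: decidable_def)
qed

lemma decidable_less: "computable k F \<Longrightarrow> computable k G \<Longrightarrow> decidable k (\<lambda>xs. F xs < G xs)"
  unfolding less_eq_Suc_le by (intro decidable_le computable_Suc)

lemma decidable_conj: "decidable k P \<Longrightarrow> decidable k Q \<Longrightarrow> decidable k (\<lambda>xs. P xs \<and> Q xs)"
  unfolding decidable_def of_bool_conj by (rule computable_mult)

lemma decidable_eq: "computable k F \<Longrightarrow> computable k G \<Longrightarrow> decidable k (\<lambda>xs. F xs = G xs)"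
  unfolding order_eq_iff by (intro decidable_conj decidable_le)

lemma decidable_not: "decidable k P \<Longrightarrow> decidable k (\<lambda>xs. \<not> P xs)"
proof -
  assume "decidable k P"
  then have "computable k (\<lambda>xs. 1 - of_bool (P xs))"
    unfolding decidable_def by (intro computable_diff computable_const)
  moreover have "1 - of_bool (P xs) = (of_bool (\<not> P xs) :: nat)" for xs by simp
  ultimately show ?thesis by (simp add: decidable_def)
qed

lemma decidable_bex:
  assumes "computable k N" "decidable (Suc k) (\<lambda>ys. P (hd ys) (tl ys))"
  shows "decidable k (\<lambda>xs. \<exists>i<N xs. P i xs)"
proof -
  have "decidable k (\<lambda>xs. 1 \<le> (\<Sum>i<N xs. of_bool (P i xs) :: nat))"
    by (intro decidable_le computable_const computable_sum assms(1))
      (use assms(2) in \<open>simp add: decidable_def\<close>)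
  moreover have "1 \<le> (\<Sum>i<N xs. of_bool (P i xs) :: nat) \<longleftrightarrow> (\<exists>i<N xs. P i xs)" for xs
    by (simp add: Suc_le_eq card_gt_0_iff) blast
  ultimately show ?thesis by simp
qed

lemma computable_of_bool: "decidable k P \<Longrightarrow> computable k (\<lambda>xs. of_bool (P xs))"
  by (simp add: decidable_def)

text \<open>\<open>Mu\<close> looks for a zero, whence the negation. Since \<open>h\<close> is
  total, its demand for positive values at smaller arguments just says that the least witness is
  meant.\<close>

lemma reval_Mu_decidable:
  assumes "decidable (Suc k) (\<lambda>ys. P (hd ys) (tl ys))"
  obtains r where "\<And>xs. length xs = k \<Longrightarrow>
    reval r xs = (if \<exists>z. P z xs then Some (LEAST z. P z xs) else None)"
proof -
  have "computable (Suc k) (\<lambda>ys. of_bool (\<not> P (hd ys) (tl ys)))"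
    using decidable_not[OF assms] by (simp add: decidable_def)
  then obtain h where h: "\<And>ys. length ys = Suc k \<Longrightarrow> reval h ys = Some (of_bool (\<not> P (hd ys) (tl ys)))"
    unfolding computable_def by blast
  have "reval (Mu h) xs = (if \<exists>z. P z xs then Some (LEAST z. P z xs) else None)" if "length xs = k" for xs
  proof -
    have h': "reval h (z # xs) = Some (of_bool (\<not> P z xs))" for z
      using h[of "z # xs"] that by simp
    have "(\<exists>z. P z xs \<and> (\<forall>y<z. \<not> P y xs)) \<longleftrightarrow> (\<exists>z. P z xs)"
      using exists_least_iff[of "\<lambda>z. P z xs"] by auto
    moreover have "(\<exists>v. of_bool (\<not> P y xs) = Suc v) \<longleftrightarrow> \<not> P y xs" for y
      by auto
    ultimately show ?thesis by (simp add: h')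
  qed
  then show ?thesis using that by blast
qed

lemma computable_Least:
  assumes "decidable (Suc k) (\<lambda>ys. P (hd ys) (tl ys))" "\<And>xs. length xs = k \<Longrightarrow> \<exists>z. P z xs"
  shows "computable k (\<lambda>xs. LEAST z. P z xs)"
proof -
  obtain r where "\<And>xs. length xs = k \<Longrightarrow>
      reval r xs = (if \<exists>z. P z xs then Some (LEAST z. P z xs) else None)"
    using reval_Mu_decidable[of k P] assms(1) by blast
  then show ?thesis
    unfolding computable_def using assms(2) by (intro exI[of _ r]) auto
qed

text \<open>Each bound variable of a sum, a bounded quantifier or a minimization becomes the new
  head of the argument list. This rule and its companions below project through up to three such
  layers.\<close>

lemma computable_hd: "0 < k \<Longrightarrow> computable k (\<lambda>ys. hd ys)"
  using computable_nth[of 0 k] by (subst computable_cong[where G = "\<lambda>ys. ys ! 0"])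
    (auto simp: hd_conv_nth)

lemma computable_tl_nth: "Suc i < k \<Longrightarrow> computable k (\<lambda>ys. tl ys ! i)"
  using computable_nth[of "Suc i" k]
  by (subst computable_cong[where G = "\<lambda>ys. ys ! Suc i"]) (auto simp: nth_tl)

lemma computable_tl_tl_nth: "Suc (Suc i) < k \<Longrightarrow> computable k (\<lambda>ys. tl (tl ys) ! i)"
  using computable_nth[of "Suc (Suc i)" k]
  by (subst computable_cong[where G = "\<lambda>ys. ys ! Suc (Suc i)"]) (auto simp: nth_tl)

lemma computable_hd_tl: "1 < k \<Longrightarrow> computable k (\<lambda>ys. hd (tl ys))"
  using computable_nth[of 1 k] by (subst computable_cong[where G = "\<lambda>ys. ys ! 1"])
    (auto simp: hd_conv_nth nth_tl length_greater_0_conv[symmetric] simp del: length_greater_0_conv)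

lemma computable_tl_tl_tl_nth: "i + 3 < k \<Longrightarrow> computable k (\<lambda>ys. tl (tl (tl ys)) ! i)"
  using computable_nth[of "i + 3" k]
  by (subst computable_cong[where G = "\<lambda>ys. ys ! (i + 3)"]) (auto simp: nth_tl numeral_3_eq_3)

lemma computable_hd_tl_tl: "2 < k \<Longrightarrow> computable k (\<lambda>ys. hd (tl (tl ys)))"
  using computable_nth[of 2 k] by (subst computable_cong[where G = "\<lambda>ys. ys ! 2"])
    (auto simp: hd_conv_nth nth_tl length_greater_0_conv[symmetric] numeral_2_eq_2
      simp del: length_greater_0_conv)

lemmas computable_intros =
  computable_const computable_nth computable_hd computable_tl_nth computable_hd_tl
  computable_tl_tl_nth computable_hd_tl_tl computable_tl_tl_tl_nth computable_Suc computable_add computable_diff computable_mult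
  computable_power2 computable_sum computable_of_bool
  decidable_le decidable_less decidable_eq decidable_conj decidable_bex

text \<open>\<open>n div 2\<close> is the number of positive even numbers up to
  \<open>n\<close>.\<close>

lemma computable_half:
  assumes "computable k F"
  shows "computable k (\<lambda>xs. F xs div 2)"
proof -
  have "computable 1 (\<lambda>xs. \<Sum>i<xs ! 0. of_bool (2 * Suc i \<le> xs ! 0))"
    by (intro computable_intros) simp_all
  moreover have "(\<Sum>i<n. of_bool (2 * Suc i \<le> n)) = n div 2" for n :: nat
  proof -
    have "{i. i < n \<and> 2 * Suc i \<le> n} = {..<n div 2}" by auto
    then show ?thesis by (simp add: of_bool_def flip: sum.inter_filter) 
  qed
  ultimately show ?thesis using computable_apply[OF _ assms, of "\<lambda>n. n div 2"] by simp
qed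

lemma decidable_even:
  assumes "computable k F"
  shows "decidable k (\<lambda>xs. even (F xs))"
proof -
  have "decidable k (\<lambda>xs. 2 * (F xs div 2) = F xs)"
    by (intro computable_intros computable_half assms)
  moreover have "2 * (n div 2) = n \<longleftrightarrow> even n" for n :: nat by presburger
  ultimately show ?thesis by simp
qed

text \<open>The term for \<open>f\<close> says nothing about its value at 0, so only the shifted
  function is available as a total one.\<close>

lemma total_recursive_computable:
  assumes "total_recursive_nat f"
  shows "computable 1 (\<lambda>xs. f (Suc (xs ! 0)))"
proof -
  obtain r where "\<And>n. n \<ge> 1 \<Longrightarrow> reval r [n] = Some (f n)"
    using assms unfolding total_recursive_nat_def by blast
  then show ?thesis
    unfolding computable_def
    by (intro exI[of _ "Comp r [Succ]"]) (auto simp: length_Suc_conv)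
qed

section \<open>Bijective base-two codes and the blocks 1^k 0 w\<close>

section \<open>Codes of strings\<close>

lemma str_code_inv [simp]: "str_code (inv str_code n) = n"
  by (simp add: bij_str_code bij_is_surj surj_f_inv_f)

lemma inv_str_code [simp]: "inv str_code (str_code w) = w"
  by (simp add: bij_str_code bij_is_inj)

lemma str_code_eq_iff [simp]: "str_code v = str_code w \<longleftrightarrow> v = w"
  by (metis inv_str_code)

text \<open>In binary, \<open>str_code w + 1\<close> is a leading 1 followed by the letters of
  \<open>w\<close> as digits, the head of \<open>w\<close> being the least significant.\<close>

lemma str_code_bounds: "2 ^ length w \<le> str_code w + 1" "str_code w + 1 < 2 * 2 ^ length w"
  by (induction w) auto

lemma length_str_code:
  assumes "2 ^ l \<le> str_code w + 1" "str_code w + 1 < 2 * 2 ^ l"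
  shows "length w = l"
proof -
  have "(2::nat) ^ l < 2 ^ Suc (length w)" "(2::nat) ^ length w < 2 ^ Suc l"
    using assms str_code_bounds[of w] by (simp_all only: power_Suc)
  then have "l < Suc (length w)" "length w < Suc l"
    by (simp_all del: power_Suc)
  then show ?thesis by simp
qed

text \<open>Prepending \<open>True\<close> doubles the code plus 2, while prepending
  \<open>False\<close> makes it odd. So \<open>k\<close> is the exponent of 2 in the code plus 2,
  and a block can be decoded arithmetically.\<close>

lemma str_code_block: "str_code (replicate k True @ False # w) + 2 = 2 ^ k * (2 * str_code w + 3)"
  by (induction k) auto

lemma block_inject:
  "replicate k True @ False # w = replicate k' True @ False # w' \<longleftrightarrow> k = k' \<and> w = w'"
proof (induction k arbitrary: k')
  case 0
  then show ?case by (cases k') auto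
next
  case (Suc k)
  then show ?case by (cases k') auto
qed

text \<open>The leading run of ones determines \<open>k\<close> and hence the total length, whereas
  a strict prefix would be shorter.\<close>

lemma prefix_free_blocks:
  assumes "\<And>p. p \<in> S \<Longrightarrow> \<exists>k w. p = replicate k True @ False # w \<and> length w = l k"
  shows "prefix_free S"
proof -
  have *: "k = k' \<and> strict_prefix w w'"
    if "strict_prefix (replicate k True @ False # w) (replicate k' True @ False # w')"
    for k k' w w'
    using that
  proof (induction k arbitrary: k')
    case 0
    then show ?case by (cases k') auto
  next
    case (Suc k)
    then show ?case by (cases k') auto
  qed
  show ?thesis
    unfolding prefix_free_def using assms * by (metis nat_less_le prefix_length_less)
qed

section \<open>From thresholds to stages of the enumeration\<close>

section \<open>The threshold computer\<close>

text \<open>For positive \<open>b t\<close>, the inequality says that the fraction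
  \<open>a t / b t\<close> has reached m / 2^(l k), cleared of denominators. The output names a
  stage at which this happens.\<close>

lemma threshold_computer:
  assumes l: "computable 1 (\<lambda>xs. l (xs ! 0))"
    and a: "computable 1 (\<lambda>xs. a (xs ! 0))" and b: "computable 1 (\<lambda>xs. b (xs ! 0))"
  obtains C where "computer C"
    and "\<And>k m t. m < 2 ^ l k \<Longrightarrow> m * b t \<le> 2 ^ l k * a t \<Longrightarrow>
      \<exists>p\<in>dom C. length p = Suc (k + l k) \<and>
        (\<exists>t'. C p = Some (inv str_code t') \<and> m * b t' \<le> 2 ^ l k * a t')"
proof -
  \<comment> \<open>By \<open>str_code_block\<close>, \<open>x + 2 = 2 ^ k * (2 * y + 3)\<close> means that \<open>x\<close> is the code of \<open>1\<^sup>k0w\<close> for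
    the \<open>w\<close> with code \<open>y\<close>; the strings of length \<open>l k\<close> have the codes \<open>2 ^ l k - 1 + m\<close> with
    \<open>m < 2 ^ l k\<close>.\<close>
  define R where "R t x \<longleftrightarrow> (\<exists>k<Suc x. \<exists>y<Suc x. x + 2 = 2 ^ k * (2 * y + 3) \<and>
    2 ^ l k \<le> y + 1 \<and> y + 1 < 2 * 2 ^ l k \<and> (y + 1 - 2 ^ l k) * b t \<le> 2 ^ l k * a t)" for t x
  note app = computable_apply[OF l] computable_apply[OF a] computable_apply[OF b]
  have "decidable (Suc 1) (\<lambda>ys. R (hd ys) (tl ys ! 0))"
    unfolding R_def by (intro computable_intros app) simp_all
  then obtain r where r: "\<And>xs. length xs = 1 \<Longrightarrow>
      reval r xs = (if \<exists>t. R t (xs ! 0) then Some (LEAST t. R t (xs ! 0)) else None)"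
    by (rule reval_Mu_decidable[where P = "\<lambda>t xs. R t (xs ! 0)"]) blast
  define C where "C p = (if \<exists>t. R t (str_code p) then Some (inv str_code (LEAST t. R t (str_code p)))
    else None)" for p
  have R_block: "R t (str_code (replicate k True @ False # w)) \<longleftrightarrow>
      length w = l k \<and> (str_code w + 1 - 2 ^ l k) * b t \<le> 2 ^ l k * a t" (is "?L \<longleftrightarrow> ?R") for t k w
  proof
    let ?x = "str_code (replicate k True @ False # w)"
    assume ?L
    then obtain k' y where y: "?x + 2 = 2 ^ k' * (2 * y + 3)"
      "2 ^ l k' \<le> y + 1" "y + 1 < 2 * 2 ^ l k'" "(y + 1 - 2 ^ l k') * b t \<le> 2 ^ l k' * a t"
      unfolding R_def by blast
    have "?x + 2 = str_code (replicate k' True @ False # inv str_code y) + 2"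
      using y(1) by (simp only: str_code_block[of k'] str_code_inv)
    then have "replicate k True @ False # w = replicate k' True @ False # inv str_code y"
      by simp
    then have "k = k' \<and> w = inv str_code y" by (simp only: block_inject)
    then show ?R using y length_str_code[of "l k" w] by simp
  next
    let ?x = "str_code (replicate k True @ False # w)"
    assume ?R
    \<comment> \<open>The quantifiers in \<open>R\<close> are bounded to make it decidable, so
      \<open>k\<close> and the code of \<open>w\<close> have to be at most \<open>?x\<close>. From k
      + 1 <= 2^k follows 3 (k + 1) <= \<open>?x + 2\<close>.\<close>
    have "k < 2 ^ k" by simp
    then have "Suc k * 3 \<le> ?x + 2"
      unfolding str_code_block by (intro mult_le_mono Suc_leI) simp_all
    moreover have "2 * str_code w + 3 \<le> ?x + 2"
      unfolding str_code_block by simp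
    ultimately have "k < Suc ?x" "str_code w < Suc ?x" by simp_all
    moreover have "2 ^ l k \<le> str_code w + 1" "str_code w + 1 < 2 * 2 ^ l k"
      using str_code_bounds[of w] \<open>?R\<close> by simp_all
    ultimately show ?L
      using str_code_block[of k w] \<open>?R\<close> unfolding R_def by blast
  qed
  have R_dom: "\<exists>k w. p = replicate k True @ False # w \<and> length w = l k" if "R t (str_code p)" for t p
  proof -
    obtain k y where y: "str_code p + 2 = 2 ^ k * (2 * y + 3)"
      using \<open>R t (str_code p)\<close> unfolding R_def by blast
    then have "str_code p + 2 = str_code (replicate k True @ False # inv str_code y) + 2"
      by (simp only: str_code_block str_code_inv)
    then have "p = replicate k True @ False # inv str_code y" by simp
    then show ?thesis using that R_block by blast
  qed
  have "computer C"
    unfolding computer_def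
  proof
    have "reval r [str_code p] = map_option str_code (C p)" for p
      using r[of "[str_code p]"] by (simp add: C_def)
    then show "partial_recursive_str C" unfolding partial_recursive_str_def by blast
    show "prefix_free (dom C)"
      by (rule prefix_free_blocks[where l = l]) (use R_dom in \<open>auto simp: C_def split: if_splits\<close>)
  qed
  moreover have "\<exists>p\<in>dom C. length p = Suc (k + l k) \<and>
        (\<exists>t'. C p = Some (inv str_code t') \<and> m * b t' \<le> 2 ^ l k * a t')"
    if m: "m < 2 ^ l k" "m * b t \<le> 2 ^ l k * a t" for k m t
  proof -
    define w where "w = inv str_code (2 ^ l k + m - 1)"
    have w: "str_code w + 1 = 2 ^ l k + m" by (simp add: w_def)
    have len: "length w = l k" by (rule length_str_code) (use w m in auto)
    let ?p = "replicate k True @ False # w"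
    let ?t = "LEAST t. R t (str_code ?p)"
    have R: "R t' (str_code ?p) \<longleftrightarrow> m * b t' \<le> 2 ^ l k * a t'" for t'
      unfolding R_block using len w by simp
    then have "R t (str_code ?p)" using m by blast
    then have "R ?t (str_code ?p)" by (rule LeastI)
    moreover have "C ?p = Some (inv str_code ?t)"
      using \<open>R t (str_code ?p)\<close> by (auto simp: C_def)
    ultimately show ?thesis using R len by (intro bexI[of _ ?p]) auto
  qed
  ultimately show ?thesis using that by blast
qed

section \<open>A bound on the outputs of V, read off from its domain\<close>

section \<open>Simulation with a halting oracle\<close>

lemma computable_program:
  assumes "computable (length as) F" "set as \<subseteq> {..<b}" "d < b"
  obtains c where "asks c = 0"
    and "\<And>A s t xs. (\<And>j. b \<le> j \<Longrightarrow> s j = []) \<Longrightarrow> map s as = map num xs \<Longrightarrow>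
      t = s(d := num (F xs)) \<Longrightarrow> exec A c s t"
proof -
  obtain r where r: "\<And>xs. length xs = length as \<Longrightarrow> reval r xs = Some (F xs)"
    using assms(1) unfolding computable_def by blast
  obtain c where c: "assigns b c r as d"
    using recf_program assms(2,3) by blast
  have "exec A c s t" if "\<And>j. b \<le> j \<Longrightarrow> s j = []" "map s as = map num xs" "t = s(d := num (F xs))"
    for A s t xs
    by (rule assigns_exec[OF c that(1,2) r that(3)]) (use that(2) in \<open>auto dest: map_eq_imp_length_eq\<close>)
  moreover have "asks c = 0" using c by (simp add: assigns_def)
  ultimately show ?thesis using that by blast
qed

text \<open>An if-then-else made of two loops: stack 9 is a flag for the else branch, lowered by the
  first loop when the bit on stack 8 is set.\<close>

definition push_bit :: "nat \<Rightarrow> com" where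
  "push_bit i = Push 9 True ;; While 8 (Pop 8 ;; Pop 9 ;; Push i True) ;;
     While 9 (Pop 9 ;; Push i False)"

lemma exec_push_bit:
  assumes "s 8 = num (of_bool b)" "s 9 = []" "i < 8" "t = s(8 := [], i := b # s i)"
  shows "exec A (push_bit i) s t"
proof -
  let ?l = "Pop 8 ;; Pop 9 ;; Push i True" and ?r = "Pop 9 ;; Push i False"
  let ?t = "s(8 := [], i := b # s i)"
  have push: "exec A (Push 9 True) s (s(9 := [True]))"
    by (rule exec_Push) (use assms in simp)
  have "exec A (push_bit i) s ?t"
  proof (cases b)
    case True
    have "exec A ?l (s(9 := [True])) ?t"
      by (rule exec.Seq[OF exec_Pop[OF refl] exec.Seq[OF exec_Pop[OF refl] exec_Push]])
        (use assms True in \<open>auto simp: fun_eq_iff\<close>)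
    then have "exec A (While 8 ?l) (s(9 := [True])) ?t"
      by (rule exec.While_step[rotated, OF _ exec.While_done]) (use assms True in auto)
    moreover have "exec A (While 9 ?r) ?t ?t"
      by (rule exec.While_done) (use assms in auto)
    ultimately show ?thesis
      unfolding push_bit_def using push by (blast intro: exec.Seq)
  next
    case False
    have "exec A (While 8 ?l) (s(9 := [True])) (s(9 := [True]))"
      by (rule exec.While_done) (use assms False in auto)
    moreover have "exec A ?r (s(9 := [True])) ?t"
      by (rule exec.Seq[OF exec_Pop[OF refl] exec_Push])
        (use assms False in \<open>auto simp: fun_eq_iff\<close>)
    then have "exec A (While 9 ?r) (s(9 := [True])) ?t"
      by (rule exec.While_step[rotated, OF _ exec.While_done]) (use assms in auto)
    ultimately show ?thesis
      unfolding push_bit_def using push by (blast intro: exec.Seq)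
  qed
  then show ?thesis using assms(4) by simp
qed

text \<open>
  The letters are read off the code in stack \<open>4\<close> in order, so they end up reversed on stack \<open>i\<close>;
  stack \<open>5\<close> keeps track of the code of the string on stack \<open>i\<close>.
\<close>

lemma write_program:
  assumes i: "i = 1 \<or> i = 2"
  obtains c where "asks c = 0"
    and "\<And>A s t w. (\<And>j. 8 \<le> j \<Longrightarrow> s j = []) \<Longrightarrow> s 4 = num (str_code w) \<Longrightarrow>
      s 5 = num (str_code (s i)) \<Longrightarrow>
      t = s(4 := [], 5 := num (str_code (rev w @ s i)), i := rev w @ s i) \<Longrightarrow> exec A c s t"
proof -
  \<comment> \<open>A nonzero code x is even exactly if its first letter is \<open>True\<close>, and
    the remaining letters have the code (x - 1) div 2.\<close>
  have "computable (length [4::nat]) (\<lambda>xs. of_bool (even (xs ! 0)))"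
    by (intro computable_intros decidable_even) simp
  then obtain c1 where c1: "asks c1 = 0"
    "\<And>A s t xs. (\<And>j. 10 \<le> j \<Longrightarrow> s j = []) \<Longrightarrow> map s [4] = map num xs \<Longrightarrow>
      t = s(8 := num (of_bool (even (xs ! 0)))) \<Longrightarrow> exec A c1 s t"
    by (rule computable_program[where b = 10 and d = 8]) (auto intro: that)
  have "computable (length [4::nat, 5]) (\<lambda>xs. 2 * xs ! 1 + 1 + of_bool (even (xs ! 0)))"
    by (intro computable_intros decidable_even) simp_all
  then obtain c2 where c2: "asks c2 = 0"
    "\<And>A s t xs. (\<And>j. 10 \<le> j \<Longrightarrow> s j = []) \<Longrightarrow> map s [4, 5] = map num xs \<Longrightarrow>
      t = s(5 := num (2 * xs ! 1 + 1 + of_bool (even (xs ! 0)))) \<Longrightarrow> exec A c2 s t"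
    by (rule computable_program[where b = 10 and d = 5]) (auto intro: that)
  have "computable (length [4::nat]) (\<lambda>xs. (xs ! 0 - 1) div 2)"
    by (intro computable_intros computable_half) simp
  then obtain c3 where c3: "asks c3 = 0"
    "\<And>A s t xs. (\<And>j. 10 \<le> j \<Longrightarrow> s j = []) \<Longrightarrow> map s [4] = map num xs \<Longrightarrow>
      t = s(4 := num ((xs ! 0 - 1) div 2)) \<Longrightarrow> exec A c3 s t"
    by (rule computable_program[where b = 10 and d = 4]) (auto intro: that)
  define body where "body = c1 ;; c2 ;; c3 ;; push_bit i"
  have "exec A (While 4 body) s (s(4 := [], 5 := num (str_code (rev w @ s i)), i := rev w @ s i))"
    if "\<And>j. 8 \<le> j \<Longrightarrow> s j = []" "s 4 = num (str_code w)" "s 5 = num (str_code (s i))" for A s w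
    using that
  proof (induction w arbitrary: s)
    case Nil
    then have "s(4 := [], 5 := num (str_code (rev [] @ s i)), i := rev [] @ s i) = s"
      by (auto simp: fun_eq_iff)
    moreover have "exec A (While 4 body) s s" using Nil by (intro exec.While_done) simp
    ultimately show ?case by (simp only:)
  next
    case (Cons b w)
    let ?z = "str_code (b # w)" and ?y = "str_code (s i)"
    define s1 where "s1 = s(8 := num (of_bool b))"
    define s2 where "s2 = s1(5 := num (str_code (b # s i)))"
    define s3 where "s3 = s2(4 := num (str_code w))"
    define s4 where "s4 = s(4 := num (str_code w), 5 := num (str_code (b # s i)), i := b # s i)"
    note s = Cons.prems
    have "exec A c1 s s1"
      by (rule c1(2)[where xs = "[?z]"]) (use s in \<open>auto simp: s1_def\<close>)
    moreover have "exec A c2 s1 s2"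
      by (rule c2(2)[where xs = "[?z, ?y]"]) (use s in \<open>auto simp: s1_def s2_def\<close>)
    moreover have "exec A c3 s2 s3"
      by (rule c3(2)[where xs = "[?z]"]) (use s in \<open>auto simp: s1_def s2_def s3_def\<close>)
    moreover have "exec A (push_bit i) s3 s4"
    proof (rule exec_push_bit[where b = b])
      show "s3 8 = num (of_bool b)" "s3 9 = []" "i < 8"
        using s(1)[of 9] i by (auto simp: s1_def s2_def s3_def)
      show "s4 = s3(8 := [], i := b # s3 i)"
        using s(1)[of 8] i by (auto simp: s1_def s2_def s3_def s4_def fun_eq_iff)
    qed
    ultimately have "exec A body s s4"
      unfolding body_def by (blast intro: exec.Seq)
    moreover have "s 4 \<noteq> []" using s by auto
    moreover have "s(4 := [], 5 := num (str_code (rev (b # w) @ s i)), i := rev (b # w) @ s i) =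
        s4(4 := [], 5 := num (str_code (rev w @ s4 i)), i := rev w @ s4 i)"
      using i by (auto simp: s4_def fun_eq_iff)
    moreover have "exec A (While 4 body) s4
        (s4(4 := [], 5 := num (str_code (rev w @ s4 i)), i := rev w @ s4 i))"
    proof (rule Cons.IH)
      show "s4 j = []" if "8 \<le> j" for j using s(1)[OF that] that i by (auto simp: s4_def)
    qed (use i in \<open>auto simp: s4_def\<close>)
    ultimately show ?case by (metis exec.While_step)
  qed
  moreover have "asks (While 4 body) = 0"
    using c1 c2 c3 by (simp add: body_def push_bit_def)
  ultimately show ?thesis using that by blast
qed

text \<open>
  Running \<open>V\<close> on all the strings accepted by the oracle, the machine obtains the sum \<open>T\<close> of
  the codes of their outputs.
\<close>

lemma oracle_machine:
  assumes V: "partial_recursive_str V"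
    and Z: "computable 2 (\<lambda>xs. Z (xs ! 0) (xs ! 1))"
  obtains M where "wf_oracle_tm M"
    and "\<And>n. \<exists>T. (\<forall>q v. V q = Some v \<longrightarrow> length q \<le> n \<longrightarrow> str_code v \<le> T) \<and>
      otm_output M (strings_upto (dom V) (int n)) n (rev (inv str_code (Z n T)))"
proof -
  obtain rV where rV: "\<And>p. reval rV [str_code p] = map_option str_code (V p)"
    using V unfolding partial_recursive_str_def by blast
  have "computable 2 (\<lambda>xs. xs ! 0 + xs ! 1)"
    by (intro computable_intros) simp_all
  then obtain radd where "\<And>xs. length xs = 2 \<Longrightarrow> reval radd xs = Some (xs ! 0 + xs ! 1)"
    unfolding computable_def by blast
  then have radd: "reval radd [x, y] = Some (x + y)" for x y
    by simp
  \<comment> \<open>The recursion counter is the oracle's answer. At 0 the step is not evaluated, so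
    a divergent run of V is never started. In the step, position 1 is the accumulator and position 3
    the code of the program.\<close>
  define rG where "rG = PrimRec (Proj 0) (Comp radd [Proj 1, Comp rV [Proj 3]])"
  have rG0: "reval rG [0, T, y] = Some T" for T y
    by (simp add: rG_def)
  have rG1: "reval rG [1, T, str_code q] = Some (T + str_code v)" if "V q = Some v" for T q v
    using that by (simp add: rG_def rV radd)
  have "\<exists>cG. assigns 10 cG rG [6, 7, 5] 7"
    by (rule recf_program) auto
  then obtain cG where cG: "assigns 10 cG rG [6, 7, 5] 7" ..
  \<comment> \<open>All strings of length at most n have codes below
    \<open>2 ^ Suc n\<close>.\<close>
  have "computable (length [0::nat]) (\<lambda>xs. 2 ^ Suc (xs ! 0))"
    by (intro computable_intros) simp
  then obtain cN where cN: "asks cN = 0"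
    "\<And>A s t xs. (\<And>j. 10 \<le> j \<Longrightarrow> s j = []) \<Longrightarrow> map s [0] = map num xs \<Longrightarrow>
      t = s(3 := num (2 ^ Suc (xs ! 0))) \<Longrightarrow> exec A cN s t"
    by (rule computable_program[where b = 10 and d = 3]) (auto intro: that)
  have "computable (length [0::nat, 7]) (\<lambda>xs. Z (xs ! 0) (xs ! 1))"
    using Z by (simp add: numeral_2_eq_2)
  then obtain cZ where cZ: "asks cZ = 0"
    "\<And>A s t xs. (\<And>j. 10 \<le> j \<Longrightarrow> s j = []) \<Longrightarrow> map s [0, 7] = map num xs \<Longrightarrow>
      t = s(4 := num (Z (xs ! 0) (xs ! 1))) \<Longrightarrow> exec A cZ s t"
    by (rule computable_program[where b = 10 and d = 4]) (auto intro: that)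
  obtain w1 where w1: "asks w1 = 0"
    "\<And>A s t w. (\<And>j. 8 \<le> j \<Longrightarrow> s j = []) \<Longrightarrow> s 4 = num (str_code w) \<Longrightarrow>
      s 5 = num (str_code (s 1)) \<Longrightarrow>
      t = s(4 := [], 5 := num (str_code (rev w @ s 1)), 1 := rev w @ s 1) \<Longrightarrow> exec A w1 s t"
    by (rule write_program[of 1]) auto
  obtain w2 where w2: "asks w2 = 0"
    "\<And>A s t w. (\<And>j. 8 \<le> j \<Longrightarrow> s j = []) \<Longrightarrow> s 4 = num (str_code w) \<Longrightarrow>
      s 5 = num (str_code (s 2)) \<Longrightarrow>
      t = s(4 := [], 5 := num (str_code (rev w @ s 2)), 2 := rev w @ s 2) \<Longrightarrow> exec A w2 s t"
    by (rule write_program[of 2]) auto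
  \<comment> \<open>Stacks: 0 the input, 1 the query, 2 the output, 3 the loop counter, 4 the code
    to be written out, 5 the code of the string written, 6 the answer, 7 the running sum.\<close>
  define body where "body = Pop 3 ;; copy 10 3 4 ;; w1 ;; Ask 6 ;; cG ;; clear 6 ;; clear 5 ;; clear 1"
  define c where "c = cN ;; While 3 body ;; cZ ;; w2"
  have asks: "asks c = 1"
    using cG cN(1) cZ(1) w1(1) w2(1) by (simp add: c_def body_def assigns_def)
  obtain M where M: "wf_oracle_tm M"
    "\<And>A n s'. exec A c ((\<lambda>_. [])(0 := num n)) s' \<Longrightarrow> otm_output M A n (s' 2)"
    by (rule com_machine[OF asks]) (rule that)
  have "\<exists>T. (\<forall>q v. V q = Some v \<longrightarrow> length q \<le> n \<longrightarrow> str_code v \<le> T) \<and>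
      otm_output M (strings_upto (dom V) (int n)) n (rev (inv str_code (Z n T)))" for n
  proof -
    let ?A = "strings_upto (dom V) (int n)"
    define S :: "nat \<Rightarrow> nat \<Rightarrow> stacks" where "S T x = (\<lambda>_. [])(0 := num n, 3 := num x, 7 := num T)" for T x
    have step: "\<exists>T'\<ge>T. (\<forall>v. rev (inv str_code x) \<in> ?A \<longrightarrow> V (rev (inv str_code x)) = Some v \<longrightarrow> str_code v \<le> T') \<and>
        exec ?A body (S T (Suc x)) (S T' x)" for T x
    proof -
      \<comment> \<open>Writing reverses the string, but reversal permutes the strings of each
        length, so the loop still meets all of them.\<close>
      define q where "q = rev (inv str_code x)"
      define T' where "T' = T + (if q \<in> ?A then str_code (the (V q)) else 0)"
      define s1 where "s1 = (S T x)(4 := num x)"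
      define s2 where "s2 = (S T x)(5 := num (str_code q), 1 := q)"
      define s3 where "s3 = s2(6 := num (of_bool (q \<in> ?A)))"
      have "exec ?A (Pop 3) (S T (Suc x)) (S T x)"
        by (rule exec_Pop) (auto simp: S_def fun_eq_iff)
      moreover have "exec ?A (copy 10 3 4) (S T x) s1"
        by (rule exec_copy) (auto simp: S_def s1_def)
      moreover have "exec ?A w1 s1 s2"
        by (rule w1(2)[where w = "inv str_code x"])
          (auto simp: S_def s1_def s2_def q_def fun_eq_iff)
      moreover have "exec ?A (Ask 6) s2 s3"
        by (rule exec_Ask) (auto simp: S_def s2_def s3_def fun_eq_iff)
      moreover have "exec ?A cG s3 (s3(7 := num T'))"
      proof (rule assigns_exec[OF cG, where xs = "[of_bool (q \<in> ?A), T, str_code q]"])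
        show "reval rG [of_bool (q \<in> ?A), T, str_code q] = Some T'"
        proof (cases "q \<in> ?A")
          case True
          then obtain v where "V q = Some v" by (auto simp: strings_upto_def)
          then show ?thesis using True rG1 by (simp add: T'_def)
        qed (simp add: T'_def rG0)
      qed (auto simp: S_def s2_def s3_def)
      moreover have "exec ?A (clear 6 ;; clear 5 ;; clear 1) (s3(7 := num T')) (S T' x)"
        by (rule exec.Seq[OF exec_clear[OF refl] exec.Seq[OF exec_clear[OF refl] exec_clear]])
          (auto simp: S_def s2_def s3_def fun_eq_iff)
      ultimately have "exec ?A body (S T (Suc x)) (S T' x)"
        unfolding body_def by (blast intro: exec.Seq)
      then show ?thesis
        by (intro exI[of _ T']) (auto simp: T'_def q_def)
    qed
    have "\<exists>T'\<ge>T. (\<forall>q v. q \<in> ?A \<longrightarrow> str_code (rev q) < x \<longrightarrow> V q = Some v \<longrightarrow> str_code v \<le> T') \<and>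
        exec ?A (While 3 body) (S T x) (S T' 0)" for T x
    proof (induction x arbitrary: T)
      case 0
      have "exec ?A (While 3 body) (S T 0) (S T 0)"
        by (rule exec.While_done) (simp add: S_def)
      then show ?case by auto
    next
      case (Suc x)
      obtain T1 where T1: "T \<le> T1" "exec ?A body (S T (Suc x)) (S T1 x)"
        "\<And>v. rev (inv str_code x) \<in> ?A \<Longrightarrow> V (rev (inv str_code x)) = Some v \<Longrightarrow> str_code v \<le> T1"
        using step by blast
      obtain T2 where T2: "T1 \<le> T2" "exec ?A (While 3 body) (S T1 x) (S T2 0)"
        "\<And>q v. q \<in> ?A \<Longrightarrow> str_code (rev q) < x \<Longrightarrow> V q = Some v \<Longrightarrow> str_code v \<le> T2"
        using Suc by blast
      have "S T (Suc x) 3 \<noteq> []" by (simp add: S_def)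
      then have "exec ?A (While 3 body) (S T (Suc x)) (S T2 0)"
        using T1(2) T2(2) by (rule exec.While_step)
      moreover have "str_code v \<le> T2" if "q \<in> ?A" "str_code (rev q) < Suc x" "V q = Some v" for q v
      proof (cases "str_code (rev q) = x")
        case True
        then have "q = rev (inv str_code x)" by auto
        then show ?thesis using T1(3) T2(1) that by force
      next
        case False
        then show ?thesis using T2(3) that by auto
      qed
      ultimately show ?case using T1(1) T2(1) by (intro exI[of _ T2]) auto
    qed
    then obtain T where T:
      "\<And>q v. q \<in> ?A \<Longrightarrow> str_code (rev q) < 2 ^ Suc n \<Longrightarrow> V q = Some v \<Longrightarrow> str_code v \<le> T"
      "exec ?A (While 3 body) (S 0 (2 ^ Suc n)) (S T 0)"
      by blast
    have "str_code v \<le> T" if "V q = Some v" "length q \<le> n" for q v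
    proof (rule T(1))
      have "str_code (rev q) + 1 < 2 * 2 ^ length q"
        using str_code_bounds(2)[of "rev q"] by simp
      also have "\<dots> \<le> 2 * 2 ^ n" using that by simp
      finally show "str_code (rev q) < 2 ^ Suc n" by simp
    qed (use that in \<open>auto simp: strings_upto_def\<close>)
    moreover have "otm_output M ?A n (rev (inv str_code (Z n T)))"
    proof -
      let ?s = "(S T 0)(4 := num (Z n T))"
      let ?w = "rev (inv str_code (Z n T))"
      have "exec ?A cN ((\<lambda>_. [])(0 := num n)) (S 0 (2 ^ Suc n))"
        by (rule cN(2)[where xs = "[n]"]) (auto simp: S_def fun_eq_iff)
      moreover have "exec ?A cZ (S T 0) ?s"
        by (rule cZ(2)[where xs = "[n, T]"]) (auto simp: S_def)
      moreover have "exec ?A w2 ?s (?s(4 := [], 5 := num (str_code ?w), 2 := ?w))"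
        by (rule w2(2)[where w = "inv str_code (Z n T)"]) (auto simp: S_def)
      ultimately have "exec ?A c ((\<lambda>_. [])(0 := num n)) (?s(4 := [], 5 := num (str_code ?w), 2 := ?w))"
        unfolding c_def using T(2) by (blast intro: exec.Seq)
      from M(2)[OF this] show ?thesis by simp
    qed
    ultimately show ?thesis by blast
  qed
  then show ?thesis using that M(1) by blast
qed

section \<open>Fractions below the fractional part of \<alpha>\<close>

section \<open>Approximation from below\<close>

text \<open>The floor of \<alpha> is a fixed integer and can be built into the recursive functions.
  Since the fractional part is nonnegative, negative approximations may be replaced by 0, so
  numerators and denominators are natural numbers.\<close>

lemma re_real_fractions:
  assumes "re_real \<alpha>"
  defines "q \<equiv> \<lambda>m. nat \<lfloor>2 ^ m * (\<alpha> - of_int \<lfloor>\<alpha>\<rfloor>)\<rfloor>"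
  obtains a b :: "nat \<Rightarrow> nat"
  where "computable 1 (\<lambda>xs. a (xs ! 0))" "computable 1 (\<lambda>xs. b (xs ! 0))"
    and "\<And>m t x. x * b t \<le> 2 ^ m * a t \<Longrightarrow> x \<le> q m"
    and "\<And>m. \<exists>t. q m * b t \<le> 2 ^ m * a t"
proof -
  define \<beta> where "\<beta> = \<alpha> - of_int \<lfloor>\<alpha>\<rfloor>"
  have \<beta>: "0 \<le> \<beta>" unfolding \<beta>_def by linarith
  have q: "q m = nat \<lfloor>2 ^ m * \<beta>\<rfloor>" for m
    by (simp add: q_def \<beta>_def)
  have q_real: "real (q m) = of_int \<lfloor>2 ^ m * \<beta>\<rfloor>" for m
    unfolding q using \<beta> by (intro of_nat_nat) simp
  have upper: "x \<le> q m" if "0 < b" "real a \<le> \<beta> * real b" "x * b \<le> 2 ^ m * a" for a b m x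
  proof -
    have "real (x * b) \<le> real (2 ^ m * a)" using that(3) by (simp only: of_nat_le_iff)
    then have "real x * real b \<le> 2 ^ m * real a" by simp
    also have "\<dots> \<le> 2 ^ m * (\<beta> * real b)" using that(2) by simp
    finally have "real x * real b \<le> (2 ^ m * \<beta>) * real b" by (simp add: mult.assoc)
    then have "real x \<le> 2 ^ m * \<beta>" using that(1) by simp
    then show ?thesis unfolding q by (simp add: le_nat_floor)
  qed
  \<comment> \<open>If \<open>\<beta>\<close> is dyadic, then the given approximations might never reach it; use \<open>\<beta>\<close> itself.\<close>
  show ?thesis
  proof (cases "\<beta> \<in> \<rat>")
    case True
    then obtain a b :: nat where ab: "b \<noteq> 0" "\<bar>\<beta>\<bar> = real a / real b"
      by (rule Rats_abs_nat_div_natE)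
    then have eq: "real a = \<beta> * real b" using \<beta> by simp
    have "q m * b \<le> 2 ^ m * a" for m
    proof -
      have "real (q m) \<le> 2 ^ m * \<beta>" unfolding q_real by simp
      then have "real (q m) * real b \<le> 2 ^ m * \<beta> * real b" by (simp add: mult_right_mono)
      then have "real (q m * b) \<le> real (2 ^ m * a)" by (simp add: eq mult.assoc)
      then show ?thesis by (simp only: of_nat_le_iff)
    qed
    then show ?thesis
      using that[of "\<lambda>_. a" "\<lambda>_. b"] upper[of b a] ab eq by (simp add: computable_const)
  next
    case False
    obtain g s a b where g: "\<And>n. n \<ge> 1 \<Longrightarrow> of_rat (g n) \<le> \<alpha>" "(\<lambda>n. of_rat (g n)) \<longlonglongrightarrow> \<alpha>"
      and sab: "total_recursive_nat s" "total_recursive_nat a" "total_recursive_nat b"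
      "\<And>n. n \<ge> 1 \<Longrightarrow> b n \<noteq> 0 \<and> g n = (- 1) ^ s n * of_nat (a n) / of_nat (b n)"
      using assms(1) unfolding re_real_def total_recursive_rat_def by blast
    define c d where "c = nat (- \<lfloor>\<alpha>\<rfloor>)" and "d = nat \<lfloor>\<alpha>\<rfloor>"
    define B where "B t = b (Suc t)" for t
    \<comment> \<open>Truncated subtraction makes \<open>A t / B t\<close> the positive part of \<open>g (Suc t) - \<lfloor>\<alpha>\<rfloor>\<close>.\<close>
    define A where "A t = of_bool (even (s (Suc t))) * (a (Suc t) + c * B t - d * B t) +
      (1 - of_bool (even (s (Suc t)))) * (c * B t - (a (Suc t) + d * B t))" for t
    note comp = sab(1-3)[THEN total_recursive_computable]
    have "computable 1 (\<lambda>xs. B (xs ! 0))" unfolding B_def by (rule comp)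
    moreover from this have "computable 1 (\<lambda>xs. A (xs ! 0))"
      unfolding A_def by (intro computable_intros decidable_even comp) simp_all
    moreover have B: "0 < B t" for t using sab(4)[of "Suc t"] by (simp add: B_def)
    have cd: "real d - real c = of_int \<lfloor>\<alpha>\<rfloor>" by (simp add: c_def d_def)
    have A: "real (A t) = max 0 (of_rat (g (Suc t)) - of_int \<lfloor>\<alpha>\<rfloor>) * real (B t)" for t
    proof -
      have "of_rat (g (Suc t)) = (- 1) ^ s (Suc t) * real (a (Suc t)) / real (B t)"
        using sab(4)[of "Suc t"] by (simp add: B_def of_rat_divide of_rat_mult of_rat_power of_rat_minus)
      then have "(of_rat (g (Suc t)) - of_int \<lfloor>\<alpha>\<rfloor>) * real (B t) =
          (- 1) ^ s (Suc t) * real (a (Suc t)) + real c * real (B t) - real d * real (B t)"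
        unfolding cd[symmetric] using B[of t] by (simp add: field_simps)
      moreover have "max 0 x * real (B t) = max 0 (x * real (B t))" for x
        using B[of t] by (auto simp: max_def mult_le_0_iff zero_le_mult_iff)
      moreover have "real (x - y) = max 0 (real x - real y)" for x y by (simp add: max_def of_nat_diff)
      ultimately show ?thesis
        by (cases "even (s (Suc t))") (simp_all add: A_def algebra_simps)
    qed
    have lower: "\<exists>t. q m * B t \<le> 2 ^ m * A t" for m
    proof -
      \<comment> \<open>Irrationality puts the truncation strictly below
        \<open>2 ^ m * \<beta>\<close>; convergence then carries some approximation past it.\<close>
      have "2 ^ m * \<beta> \<noteq> of_int \<lfloor>2 ^ m * \<beta>\<rfloor>"
      proof
        assume "2 ^ m * \<beta> = of_int \<lfloor>2 ^ m * \<beta>\<rfloor>"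
        then have "\<beta> = of_int \<lfloor>2 ^ m * \<beta>\<rfloor> / 2 ^ m" by (simp add: field_simps)
        also have "\<dots> \<in> \<rat>" by simp
        finally show False using False by simp
      qed
      moreover have "of_int \<lfloor>2 ^ m * \<beta>\<rfloor> \<le> 2 ^ m * \<beta>" by simp
      ultimately have "real (q m) < 2 ^ m * \<beta>" unfolding q_real by linarith
      then have "real (q m) / 2 ^ m + of_int \<lfloor>\<alpha>\<rfloor> < \<alpha>"
        by (simp add: \<beta>_def field_simps)
      then have "\<forall>\<^sub>F n in sequentially. real (q m) / 2 ^ m + of_int \<lfloor>\<alpha>\<rfloor> < of_rat (g n)"
        by (rule order_tendstoD(1)[OF g(2)])
      then obtain n where "\<And>k. k \<ge> n \<Longrightarrow> real (q m) / 2 ^ m + of_int \<lfloor>\<alpha>\<rfloor> < of_rat (g k)"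
        by (auto simp: eventually_sequentially)
      then have "real (q m) / 2 ^ m + of_int \<lfloor>\<alpha>\<rfloor> < of_rat (g (Suc n))" by simp
      then have "real (q m) / 2 ^ m \<le> max 0 (of_rat (g (Suc n)) - of_int \<lfloor>\<alpha>\<rfloor>)" by linarith
      then have "real (q m) / 2 ^ m * real (B n) \<le> real (A n)"
        unfolding A by (rule mult_right_mono) simp
      then have "real (q m * B n) \<le> real (2 ^ m * A n)" by (simp add: field_simps)
      then show ?thesis by (metis of_nat_le_iff)
    qed
    moreover have "real (A t) \<le> \<beta> * real (B t)" for t
      unfolding A using g(1)[of "Suc t"] \<beta> by (intro mult_right_mono) (auto simp: \<beta>_def)
    ultimately show ?thesis
      using that[of A B] upper[OF B] by blast
  qed
qed

text \<open>After the reversal the last bit is least significant, so the code plus 1 is a leading 1,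
  worth 2^m, followed by the first m bits of the number in their usual order.\<close>

lemma str_code_bits:
  fixes \<beta> :: real
  assumes "0 \<le> \<beta>" "\<beta> < 1"
  shows "str_code (rev (map (\<lambda>i. odd \<lfloor>2 ^ Suc i * \<beta>\<rfloor>) [0..<m])) + 1 = 2 ^ m + nat \<lfloor>2 ^ m * \<beta>\<rfloor>"
proof (induction m)
  case 0
  have "\<lfloor>\<beta>\<rfloor> = 0" using assms by linarith
  then show ?case by simp
next
  case (Suc m)
  have "\<lfloor>2 ^ Suc m * \<beta>\<rfloor> = 2 * \<lfloor>2 ^ m * \<beta>\<rfloor> \<or> \<lfloor>2 ^ Suc m * \<beta>\<rfloor> = 2 * \<lfloor>2 ^ m * \<beta>\<rfloor> + 1"
    unfolding power_Suc mult.assoc by linarith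
  then have eq: "\<lfloor>2 ^ Suc m * \<beta>\<rfloor> = 2 * \<lfloor>2 ^ m * \<beta>\<rfloor> + of_bool (odd \<lfloor>2 ^ Suc m * \<beta>\<rfloor>)"
    by auto
  have "nat (2 * y + of_bool P) = 2 * nat y + of_bool P" if "0 \<le> y" for y P
    using that by (simp add: nat_add_distrib nat_mult_distrib)
  then have "nat (2 * \<lfloor>2 ^ m * \<beta>\<rfloor> + of_bool P) = 2 * nat \<lfloor>2 ^ m * \<beta>\<rfloor> + of_bool P" for P
    using assms by simp
  from trans[OF arg_cong[OF eq, of nat] this]
  show ?case using Suc by simp
qed

theorem theorem4p4:
  fixes \<alpha> :: real
    and V :: "bool list \<Rightarrow> bool list option"
    and f :: "nat \<Rightarrow> nat"
  assumes "re_real \<alpha>"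
    and "optimal_computer V"
    and "total_recursive_nat f"
    and "\<not> bdd_above (f ` {1..})"
  shows "\<exists>M (c::nat). wf_oracle_tm M \<and>
    infinite {n::nat. n \<ge> 1 \<and>
      otm_output M (strings_upto (dom V) (int n)) n (real_prefix \<alpha> (int n - int (f n) - int c))}"
proof -
  define \<beta> where "\<beta> = \<alpha> - of_int \<lfloor>\<alpha>\<rfloor>"
  have \<beta>: "0 \<le> \<beta>" "\<beta> < 1" unfolding \<beta>_def by linarith+
  define q where "q m = nat \<lfloor>2 ^ m * \<beta>\<rfloor>" for m
  have q_less: "q m < 2 ^ m" for m
  proof -
    have "2 ^ m * \<beta> < of_int (2 ^ m)" using \<beta> by simp
    then show ?thesis unfolding q_def using \<beta> by (simp add: nat_less_iff floor_less_iff)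
  qed
  obtain a b where ab: "computable 1 (\<lambda>xs. a (xs ! 0))" "computable 1 (\<lambda>xs. b (xs ! 0))"
    and upper: "\<And>m t x. x * b t \<le> 2 ^ m * a t \<Longrightarrow> x \<le> q m"
    and lower: "\<And>m. \<exists>t. q m * b t \<le> 2 ^ m * a t"
    using re_real_fractions[OF assms(1)] unfolding q_def \<beta>_def by blast
  note f = computable_apply[OF total_recursive_computable[OF assms(3)]]
  note app = f computable_apply[OF ab(1)] computable_apply[OF ab(2)]
  have f_large: "\<exists>n. x \<le> f (Suc n)" for x
  proof -
    obtain y where "y \<in> f ` {1..}" "\<not> y \<le> x"
      using assms(4) unfolding bdd_above_def by blast
    then obtain n where "n \<ge> 1" "\<not> f n \<le> x" by auto
    then show ?thesis by (intro exI[of _ "n - 1"]) simp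
  qed
  \<comment> \<open>Of the \<open>2 * k + 1\<close>, the header 1^k 0 uses k + 1, and the remaining
    k absorb the optimality constant \<open>d\<close> once \<open>d \<le> k\<close>.\<close>
  define N where "N k = (LEAST n. 2 * k + 1 \<le> f (Suc n))" for k
  have N: "2 * k + 1 \<le> f (Suc (N k))" for k
    unfolding N_def by (rule LeastI_ex[OF f_large])
  have "computable 1 (\<lambda>xs. N (xs ! 0))"
    unfolding N_def by (rule computable_Least) (intro computable_intros f | simp | rule f_large)+
  then have l: "computable 1 (\<lambda>xs. Suc (N (xs ! 0)) - f (Suc (N (xs ! 0))))"
    by (intro computable_intros f)
  define l where "l k = Suc (N k) - f (Suc (N k))" for k
  obtain C where C: "computer C"
    "\<And>k m t. m < 2 ^ l k \<Longrightarrow> m * b t \<le> 2 ^ l k * a t \<Longrightarrow>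
      \<exists>p\<in>dom C. length p = Suc (k + l k) \<and>
        (\<exists>t'. C p = Some (inv str_code t') \<and> m * b t' \<le> 2 ^ l k * a t')"
    using threshold_computer[of l a b] l ab unfolding l_def by blast
  obtain d where d: "\<And>p. p \<in> dom C \<Longrightarrow> \<exists>q\<in>dom V. V q = C p \<and> length q \<le> length p + d"
    using assms(2) C(1) unfolding optimal_computer_def by blast
  \<comment> \<open>For positive n this is n - f n, truncated; \<open>Suc (n - 1)\<close> keeps the
    argument of f positive. The machine computes this from n without knowing k.\<close>
  define len where "len n = n - f (Suc (n - 1))" for n
  \<comment> \<open>The sum counts the thresholds (x + 1) / 2^(len n) reached by some stage up to T.
    If T is large enough the count is \<open>q (len n)\<close>, and by \<open>str_code_bits\<close>
    the result is the code of the reversed prefix.\<close>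
  define Z :: "nat \<Rightarrow> nat \<Rightarrow> nat" where "Z n T = 2 ^ len n +
    (\<Sum>x<2 ^ len n. of_bool (\<exists>t<Suc T. Suc x * b t \<le> 2 ^ len n * a t)) - 1" for n T
  have "computable 2 (\<lambda>xs. Z (xs ! 0) (xs ! 1))"
    unfolding Z_def len_def by (intro computable_intros app) simp_all
  moreover have "partial_recursive_str V"
    using assms(2) by (simp add: optimal_computer_def computer_def)
  ultimately obtain M where M: "wf_oracle_tm M"
    "\<And>n. \<exists>T. (\<forall>q v. V q = Some v \<longrightarrow> length q \<le> n \<longrightarrow> str_code v \<le> T) \<and>
      otm_output M (strings_upto (dom V) (int n)) n (rev (inv str_code (Z n T)))"
    using oracle_machine[of V Z] by blast
  have out: "otm_output M (strings_upto (dom V) (int n)) n (real_prefix \<alpha> (int n - int (f n) - int 0))"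
    if k: "d \<le> k" and n: "n = Suc (N k)" for k n
  proof -
    obtain T where T: "\<And>q v. V q = Some v \<Longrightarrow> length q \<le> n \<Longrightarrow> str_code v \<le> T"
      "otm_output M (strings_upto (dom V) (int n)) n (rev (inv str_code (Z n T)))"
      using M(2) by blast
    have len: "len n = l k" by (simp add: len_def l_def n)
    have "(\<exists>t<Suc T. Suc x * b t \<le> 2 ^ l k * a t) \<longleftrightarrow> x < q (l k)" for x
    proof
      assume "x < q (l k)"
      \<comment> \<open>\<open>q 0\<close> is 0, so here \<open>l k\<close> is positive and its
        subtraction is not truncated; the estimate of the length of \<open>r\<close> below relies on
        this.\<close>
      then have "l k \<noteq> 0" using q_less[of "l k"] by (intro notI) simp
      obtain t where "q (l k) * b t \<le> 2 ^ l k * a t" using lower by blast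
      then obtain p t' where p: "p \<in> dom C" "length p = Suc (k + l k)"
        "C p = Some (inv str_code t')" "q (l k) * b t' \<le> 2 ^ l k * a t'"
        using C(2) q_less by blast
      obtain r where r: "V r = C p" "length r \<le> length p + d"
        using d[OF p(1)] by blast
      have "length r \<le> n"
        using r(2) p(2) N[of k] k \<open>l k \<noteq> 0\<close> by (simp add: l_def n)
      then have "t' \<le> T" using T(1)[of r "inv str_code t'"] r(1) p(3) by simp
      moreover have "Suc x * b t' \<le> q (l k) * b t'"
        using \<open>x < q (l k)\<close> by (intro mult_le_mono1) simp
      ultimately show "\<exists>t<Suc T. Suc x * b t \<le> 2 ^ l k * a t"
        using p(4) by (meson le_imp_less_Suc order_trans)
    qed (use upper Suc_le_eq in blast)
    then have "(\<Sum>x<2 ^ l k. of_bool (\<exists>t<Suc T. Suc x * b t \<le> 2 ^ l k * a t)) =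
        (\<Sum>x<2 ^ l k. of_bool (x < q (l k)) :: nat)"
      by (simp only:)
    also have "\<dots> = card {..<q (l k)}"
    proof -
      have "{..<2 ^ l k} \<inter> {x. x < q (l k)} = {..<q (l k)}" using q_less[of "l k"] by auto
      then show ?thesis by simp
    qed
    finally have "Z n T + 1 = 2 ^ l k + q (l k)" by (simp add: Z_def len)
    also have "\<dots> = str_code (rev (map (\<lambda>i. odd \<lfloor>2 ^ Suc i * \<beta>\<rfloor>) [0..<l k])) + 1"
      unfolding q_def by (rule str_code_bits[OF \<beta>, symmetric])
    also have "map (\<lambda>i. odd \<lfloor>2 ^ Suc i * \<beta>\<rfloor>) [0..<l k] = real_prefix \<alpha> (int n - int (f n) - int 0)"
    proof -
      have "nat (int n - int (f n) - int 0) = l k" by (simp add: l_def n)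
      moreover have "bin_expansion \<alpha> = (\<lambda>i. odd \<lfloor>2 ^ Suc i * \<beta>\<rfloor>)"
        unfolding \<beta>_def by (rule ext) (rule bin_expansion_floor)
      ultimately show ?thesis unfolding real_prefix_def by simp
    qed
    finally show ?thesis using T(2) by simp
  qed
  \<comment> \<open>\<open>N\<close> need not be injective; the set is infinite because f is
    unbounded on it.\<close>
  have "infinite ((\<lambda>k. Suc (N k)) ` {d..})"
  proof
    assume "finite ((\<lambda>k. Suc (N k)) ` {d..})"
    then have "finite (f ` (\<lambda>k. Suc (N k)) ` {d..})" by (rule finite_imageI)
    then obtain B where "\<forall>y\<in>f ` (\<lambda>k. Suc (N k)) ` {d..}. y \<le> B"
      unfolding finite_nat_set_iff_bounded_le by blast
    then have B: "f (Suc (N k)) \<le> B" if "d \<le> k" for k using that by simp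
    show False using N[of "max d B"] B[of "max d B"] by simp
  qed
  moreover have "(\<lambda>k. Suc (N k)) ` {d..} \<subseteq> {n. n \<ge> 1 \<and>
      otm_output M (strings_upto (dom V) (int n)) n (real_prefix \<alpha> (int n - int (f n) - int 0))}"
    using out by auto
  ultimately show ?thesis
    using M(1) finite_subset by blast
qed

end
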